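(* Let $B$ be a unital $C^\ast$-algebra and let $G:\mathcal{P}_2(B)\times\mathbb{H}^+(B)\to\mathbb{H}^-(B)$, $(\eta,b)\mapsto G_\eta(b)$, be the function determined by the Dyson equation $bG_\eta(b)=\mathbf{1}+\eta(G_\eta(b))G_\eta(b)$ for $b\in\mathbb{H}^+(B)$. Endow $\mathcal{P}_2(B)\times\mathbb{H}^+(B)$ with the product topology. Then: (i) For every fixed $\gamma>0$, the family of maps $\mathcal{P}_2(B)\to\mathbb{H}^-(B)$, $\eta\mapsto G_\eta(b)$, indexed by $b\in\overline{\mathbb{H}^+_\gamma(B)}$, is equicontinuous, i.e. $$\lim_{\eta\to\eta_0}\ \sup_{b\in\overline{\mathbb{H}^+_\gamma(B)}}\|G_\eta(b)-G_{\eta_0}(b)\|=0\qquad\text{for each }\eta_0\in\mathcal{P}_2(B).$$ In particular, $G:\mathcal{P}_2(B)\times\mathbb{H}^+(B)\to\mathbb{H}^-(B)$ is continuous. (ii) For every fixed $\gamma>0$, the family of maps $\mathcal{P}_2(B)\to\mathcal{L}(B)$, $\eta\mapsto(DG_\eta)(b)$, indexed by $b\in\overline{\mathbb{H}^+_\gamma(B)}$, is equicontinuous, i.e. $$\lim_{\eta\to\eta_0}\ \sup_{b\in\overline{\mathbb{H}^+_\gamma(B)}}\|(DG_\eta)(b)-(DG_{\eta_0})(b)\|=0\qquad\text{for each }\eta_0\in\mathcal{P}_2(B).$$ In particular, $DG:\mathcal{P}_2(B)\times\mathbb{H}^+(B)\to\mathcal{L}(B)$, $(\eta,b)\mapsto(DG_\eta)(b)$,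 is continuous.
   Context: $B$ is a unital $C^\ast$-algebra with unit $\mathbf{1}$; $\operatorname{Im}(b)=\frac{1}{2i}(b-b^\ast)$; $\mathbb{H}^\pm(B)=\{b\in B:\exists\,\epsilon>0,\ \pm\operatorname{Im}(b)\geq\epsilon\mathbf{1}\}$; for $\gamma>0$, $\overline{\mathbb{H}^+_\gamma(B)}=\{b\in B:\operatorname{Im}(b)\geq\gamma\mathbf{1}\}$. $\mathcal{L}(B)$ is the Banach space of bounded linear operators on $B$ with the operator norm. A map $\eta:B\to B$ is positive if it is $\mathbb{C}$-linear and maps positive elements to positive elements (automatically bounded); it is $2$-positive if its entrywise amplification $\eta^{(2)}:M_2(B)\to M_2(B)$ is positive. $\mathcal{P}_2(B)\subseteq\mathcal{L}(B)$ is the set of $2$-positive maps, with the metric induced by the operator norm. For each positive $\eta$ there is a unique function $G_\eta:\mathbb{H}^+(B)\to\mathbb{H}^-(B)$ satisfying $bG_\eta(b)=\mathbf{1}+\eta(G_\eta(b))G_\eta(b)$ for all $b\in\mathbb{H}^+(B)$ (the Dyson equation); it is holomorphic, and $(DG_\eta)(b)\in\mathcal{L}(B)$ denotes its Fréchet derivative at $b$. *)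

theory Defs
  imports "HOL-Analysis.Analysis"
begin

text \<open>
  Unital C*-algebras. The real structure, the unit, the submultiplicative norm and completeness come
  from the superclasses; \<^class>\<open>real_normed_algebra_1\<close> requires \<open>norm 1 = 1\<close>, hence a nonzero algebra
  (in which \<open>norm 1 = 1\<close> is a consequence of the C*-identity).
\<close>

class unital_cstar_algebra = real_normed_algebra_1 + banach +
  fixes scaleC :: "complex \<Rightarrow> 'a \<Rightarrow> 'a" (infixr "*\<^sub>C" 75)
    and star :: "'a \<Rightarrow> 'a"
  assumes scaleC_add_right: "c *\<^sub>C (x + y) = c *\<^sub>C x + c *\<^sub>C y"
    and scaleC_add_left: "(c + d) *\<^sub>C x = c *\<^sub>C x + d *\<^sub>C x"
    and scaleC_scaleC: "c *\<^sub>C d *\<^sub>C x = (c * d) *\<^sub>C x"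
    and scaleR_scaleC: "r *\<^sub>R x = complex_of_real r *\<^sub>C x"
    and mult_scaleC_left: "(c *\<^sub>C x) * y = c *\<^sub>C (x * y)"
    and mult_scaleC_right: "x * (c *\<^sub>C y) = c *\<^sub>C (x * y)"
    and norm_scaleC: "norm (c *\<^sub>C x) = cmod c * norm x"
    and star_add: "star (x + y) = star x + star y"
    and star_scaleC: "star (c *\<^sub>C x) = cnj c *\<^sub>C star x"
    and star_mult: "star (x * y) = star y * star x"
    and star_star: "star (star x) = x"
    and cstar_identity: "norm (star x * x) = (norm x)\<^sup>2"

instantiation complex :: unital_cstar_algebra
begin

definition scaleC_complex :: "complex \<Rightarrow> complex \<Rightarrow> complex" where
  "scaleC_complex c x = c * x"

definition star_complex :: "complex \<Rightarrow> complex" where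
  "star_complex = cnj"

instance
  by standard
    (simp_all add: scaleC_complex_def star_complex_def algebra_simps scaleR_conv_of_real
      norm_mult power2_eq_square)

end

definition positive :: "'a::unital_cstar_algebra \<Rightarrow> bool" where
  "positive a \<longleftrightarrow> (\<exists>x. a = star x * x)"

definition cstar_le :: "'a::unital_cstar_algebra \<Rightarrow> 'a \<Rightarrow> bool" where
  "cstar_le a b \<longleftrightarrow> positive (b - a)"

definition Im_part :: "'a::unital_cstar_algebra \<Rightarrow> 'a" where
  "Im_part b = (1 / (2 * \<i>)) *\<^sub>C (b - star b)"

definition upper_half :: "'a::unital_cstar_algebra set" where
  "upper_half = {b. \<exists>\<epsilon>>0. cstar_le (\<epsilon> *\<^sub>R 1) (Im_part b)}"

definition lower_half :: "'a::unital_cstar_algebra set" where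
  "lower_half = {b. \<exists>\<epsilon>>0. cstar_le (\<epsilon> *\<^sub>R 1) (- Im_part b)}"

definition upper_half_ge :: "real \<Rightarrow> 'a::unital_cstar_algebra set" where
  "upper_half_ge \<gamma> = {b. cstar_le (\<gamma> *\<^sub>R 1) (Im_part b)}"

text \<open>
  The algebra of 2-by-2 matrices over \<open>'a\<close> is \<open>'a ^ 2 ^ 2\<close> with the product \<open>**\<close>.
  Positivity has the form \<open>X* X\<close> there too, so the C*-norm of the matrix algebra is not needed.
\<close>

definition star_mat :: "'a::unital_cstar_algebra ^ 2 ^ 2 \<Rightarrow> 'a ^ 2 ^ 2" where
  "star_mat A = (\<chi> i j. star (A $ j $ i))"

definition positive_mat :: "'a::unital_cstar_algebra ^ 2 ^ 2 \<Rightarrow> bool" where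
  "positive_mat A \<longleftrightarrow> (\<exists>X. A = star_mat X ** X)"

definition amplify :: "('a \<Rightarrow> 'a) \<Rightarrow> 'a ^ 2 ^ 2 \<Rightarrow> 'a ^ 2 ^ 2" where
  "amplify \<eta> A = (\<chi> i j. \<eta> (A $ i $ j))"

text \<open>
  Elements of the type \<open>'a \<Rightarrow>\<^sub>L 'a\<close> are the bounded real-linear operators, with the operator norm;
  the complex-linear ones among them form the Banach space of bounded operators on the algebra.
\<close>

definition clinear_ops :: "('a::unital_cstar_algebra \<Rightarrow>\<^sub>L 'a) set" where
  "clinear_ops = {T. \<forall>c x. blinfun_apply T (c *\<^sub>C x) = c *\<^sub>C blinfun_apply T x}"

definition two_positive_maps :: "('a::unital_cstar_algebra \<Rightarrow>\<^sub>L 'a) set" where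
  "two_positive_maps =
     {\<eta> \<in> clinear_ops. \<forall>A. positive_mat A \<longrightarrow> positive_mat (amplify (blinfun_apply \<eta>) A)}"

definition dyson_solution ::
  "('a::unital_cstar_algebra \<Rightarrow>\<^sub>L 'a) \<Rightarrow> ('a \<Rightarrow> 'a) \<Rightarrow> bool" where
  "dyson_solution \<eta> g \<longleftrightarrow>
     (\<forall>b\<in>upper_half. g b \<in> lower_half \<and> b * g b = 1 + blinfun_apply \<eta> (g b) * g b)"

text \<open>
  The complex Frechet derivative: a real Frechet derivative that is complex-linear. The upper
  half-plane is open, so at its points only the values of \<open>g\<close> on the half-plane matter.
\<close>

definition cfrechet_deriv ::
  "('a::unital_cstar_algebra \<Rightarrow> 'a) \<Rightarrow> 'a \<Rightarrow> ('a \<Rightarrow>\<^sub>L 'a)" where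
  "cfrechet_deriv g b =
     (THE D. D \<in> clinear_ops \<and> (g has_derivative blinfun_apply D) (at b))"

end

theory Submission
  imports Defs
begin

text \<open>
  Let \<open>g\<close> be the value of the solution for \<open>\<eta>\<close> at a point \<open>b\<close> with imaginary part at least \<open>\<gamma>\<close>. The Dyson equation
  says that \<open>g\<close> is the inverse of \<open>w = b - \<eta> g\<close>, and \<open>Im_part w \<ge> \<gamma>\<close> gives \<open>norm g \<le> 1 / \<gamma>\<close>. For two points with the
  same \<open>\<eta>\<close> the difference \<open>f = w0 - w1\<close> satisfies the linear equation \<open>f = (b0 - b1) + \<eta> (g1 f g0)\<close>, and
  \<open>g1 - g0 = g1 f g0\<close>. So everything follows once the operator \<open>M x = \<eta> (g1 x g0)\<close> has powers that decay geometrically,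
  with constants that depend only on \<open>\<gamma>\<close> and \<open>norm \<eta>\<close> (\<open>dyson_points_geometric_powers\<close>).

  If \<open>g1\<close> is the adjoint of \<open>g0\<close>, then \<open>M\<close> is a positive operator. The positive element \<open>y = - Im_part g\<close> satisfies
  \<open>y = g v g*\<close> with \<open>v = Im_part b + \<eta> y\<close>. Hence \<open>u = \<gamma> + \<eta> y\<close>, which lies below \<open>v\<close>, has \<open>\<eta> (g u g*) \<le> \<eta> y = u - \<gamma>\<close>.
  As \<open>u\<close> lies between \<open>\<gamma>\<close> and a constant, the operator contracts \<open>u\<close> by a fixed factor and its powers decay on \<open>1\<close>
  (\<open>dyson_point_sandwich_dominated\<close>). For general \<open>g1\<close>, \<open>g0\<close> the operator \<open>M\<close> is the off-diagonal part of a map on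
  2-by-2 matrices that preserves positivity, since \<open>\<eta>\<close> is 2-positive; its diagonal parts are positive operators of the
  kind just discussed, and a Cauchy-Schwarz inequality transfers their decay to \<open>M\<close> (\<open>mixed_sandwich_powers_norm\<close>).

  A change of \<open>\<eta>\<close> costs nothing new: \<open>g\<close> also solves the equation for a nearby \<open>\<eta>'\<close> at the point \<open>b + (\<eta>' - \<eta>) g\<close>, whose
  imaginary part is still at least \<open>\<gamma> / 2\<close> (\<open>dyson_point_change_map\<close>). The result is a Lipschitz estimate in \<open>(\<eta>, b)\<close>,
  uniform over the half-plane. The same linear equation shows that the derivative exists and is given by the Neumann
  series of \<open>M\<close> for \<open>g1 = g0\<close> (\<open>dyson_derivative_remainder\<close>), and comparing these series gives the Lipschitz estimate
  for the derivative.

  The order theory of C*-algebras used here is developed from the C*-identity without spectral theory. Square roots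
  come from a fixed-point iteration, norm bounds from the observation that \<open>y\<^sup>2 + z\<^sup>2\<close> is \<open>u* u\<close> for \<open>u = y + \<i> z\<close>, and the
  key fact is that elements \<open>x* x\<close> have nonnegative spectrum (\<open>spec_nonneg_star_mult\<close>), so that sums of positive
  elements are positive.
\<close>

section \<open>Scalars, involution and norm\<close>

lemma scaleC_one: "(1::complex) *\<^sub>C x = (x::'a::unital_cstar_algebra)"
  using scaleR_scaleC[of 1 x] by simp

lemma scaleC_bounded_linear: "bounded_linear (\<lambda>x::'a::unital_cstar_algebra. c *\<^sub>C x)"
proof (rule bounded_linear_intro)
  show "c *\<^sub>C (r *\<^sub>R x) = r *\<^sub>R (c *\<^sub>C x)" for r and x :: 'a
    by (simp add: scaleR_scaleC scaleC_scaleC mult.commute)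
  show "norm (c *\<^sub>C x) \<le> norm x * cmod c" for x :: 'a
    by (simp add: norm_scaleC)
qed (rule scaleC_add_right)

lemmas scaleC_diff_right = bounded_linear.linear[OF scaleC_bounded_linear, THEN linear_diff]
  and scaleC_minus_right = bounded_linear.linear[OF scaleC_bounded_linear, THEN linear_neg]

lemma scaleC_minus_left: "(- c) *\<^sub>C x = - (c *\<^sub>C (x::'a::unital_cstar_algebra))"
proof -
  have "0 *\<^sub>C x = 0" using scaleR_scaleC[of 0 x] by simp
  then show ?thesis using scaleC_add_left[of c "-c" x] by (simp add: eq_neg_iff_add_eq_0 add.commute)
qed

lemma norm_le_norm_star: "norm x \<le> norm (star (x::'a::unital_cstar_algebra))"
proof (cases "x = 0")
  case False
  have "norm x * norm x \<le> norm (star x) * norm x"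
    using norm_mult_ineq[of "star x" x] by (simp add: cstar_identity power2_eq_square)
  then show ?thesis using False by simp
qed auto

lemma norm_star: "norm (star x) = norm (x::'a::unital_cstar_algebra)"
  using norm_le_norm_star[of x] norm_le_norm_star[of "star x"] by (simp add: star_star)

lemma star_bounded_linear: "bounded_linear (star :: 'a \<Rightarrow> 'a::unital_cstar_algebra)"
proof (rule bounded_linear_intro)
  show "star (r *\<^sub>R x) = r *\<^sub>R star x" for r and x :: 'a
    by (simp add: scaleR_scaleC star_scaleC)
  show "norm (star x) \<le> norm x * 1" for x :: 'a
    by (simp add: norm_star)
qed (rule star_add)

lemmas star_linear = star_bounded_linear[THEN bounded_linear.linear]
lemmas star_diff = linear_diff[OF star_linear]
  and star_minus = linear_neg[OF star_linear]
  and star_zero = linear_0[OF star_linear]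
  and star_scaleR = linear_cmul[OF star_linear]

lemma star_one: "star 1 = (1::'a::unital_cstar_algebra)"
  using star_mult[of "star 1" "1::'a"] by (simp add: star_star)

lemmas star_simps = star_add star_diff star_minus star_zero star_scaleR star_one star_mult
  star_star star_scaleC

lemma norm_square_selfadjoint:
  "star y = y \<Longrightarrow> norm (y * y) = (norm (y::'a::unital_cstar_algebra))\<^sup>2"
  using cstar_identity[of y] by simp

text \<open>
  For commuting self-adjoint \<open>y\<close>, \<open>z\<close> the
  element \<open>u = y + \<i> z\<close> satisfies \<open>star u * u = y\<^sup>2 + z\<^sup>2\<close>. It replaces the spectral theorem below.
\<close>

lemma norm_commuting_squares:
  fixes y z :: "'a::unital_cstar_algebra"
  assumes y: "star y = y" and z: "star z = z" and c: "y * z = z * y"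
  shows "(norm y)\<^sup>2 \<le> norm (y * y + z * z)"
proof -
  define u where "u = y + \<i> *\<^sub>C z"
  have su: "star u = y - \<i> *\<^sub>C z"
    by (simp add: u_def star_simps y z scaleC_minus_left)
  have "star u * u = y * y + z * z"
    by (simp add: su, simp add: u_def algebra_simps mult_scaleC_left mult_scaleC_right scaleC_scaleC c
        scaleC_minus_left scaleC_one scaleC_add_right scaleC_diff_right)
  then have n: "(norm u)\<^sup>2 = norm (y * y + z * z)"
    using cstar_identity[of u] by simp
  \<comment> \<open>\<open>y\<close> is the real part of \<open>u\<close>, hence no longer than \<open>u\<close>.\<close>
  have "2 *\<^sub>R y = u + star u" by (simp only: su) (simp add: u_def scaleR_2)
  then have "2 * norm y \<le> norm u + norm u"
    by (metis norm_scaleR norm_star norm_triangle_ineq abs_numeral)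
  then have "(norm y)\<^sup>2 \<le> (norm u)\<^sup>2" by (intro power_mono) auto
  with n show ?thesis by simp
qed

section \<open>Nonnegative elements and square roots\<close>

text \<open>
  For self-adjoint \<open>a\<close> this says that the spectrum is nonnegative: it then lies in \<open>[0, 2 t]\<close>. Unlike \<open>positive\<close>,
  this form makes it evident that sums are nonnegative; the two notions agree by
  \<open>positive_iff_spec_nonneg\<close>.
\<close>

definition spec_nonneg :: "'a::unital_cstar_algebra \<Rightarrow> bool" where
  "spec_nonneg a \<longleftrightarrow> star a = a \<and> (\<exists>t. norm (t *\<^sub>R 1 - a) \<le> t)"

lemma spec_nonneg_add: "spec_nonneg a \<Longrightarrow> spec_nonneg b \<Longrightarrow> spec_nonneg (a + b)"
proof -
  assume "spec_nonneg a" "spec_nonneg b"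
  then obtain s t where st: "norm (s *\<^sub>R 1 - a) \<le> s" "norm (t *\<^sub>R 1 - b) \<le> t"
    and sa: "star a = a" "star b = b"
    by (auto simp: spec_nonneg_def)
  have "norm ((s + t) *\<^sub>R 1 - (a + b)) \<le> norm (s *\<^sub>R 1 - a) + norm (t *\<^sub>R 1 - b)"
    by (rule order_trans[OF _ norm_triangle_ineq]) (simp add: algebra_simps)
  with st sa show ?thesis
    unfolding spec_nonneg_def by (auto simp: star_simps intro!: exI[of _ "s + t"])
qed

lemma spec_nonneg_scaleR:
  assumes "spec_nonneg a" "0 \<le> r" shows "spec_nonneg (r *\<^sub>R a)"
proof -
  obtain t where t: "norm (t *\<^sub>R 1 - a) \<le> t" and sa: "star a = a"
    using assms by (auto simp: spec_nonneg_def)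
  have "norm ((r * t) *\<^sub>R 1 - r *\<^sub>R a) = r * norm (t *\<^sub>R 1 - a)"
    using assms(2) by (metis abs_of_nonneg norm_scaleR scaleR_diff_right scaleR_scaleR)
  also have "\<dots> \<le> r * t" using t assms(2) by (simp add: mult_left_mono)
  finally show ?thesis
    using sa unfolding spec_nonneg_def by (auto simp: star_simps)
qed

lemma spec_nonneg_scalar_minus:
  "star h = h \<Longrightarrow> norm h \<le> t \<Longrightarrow> spec_nonneg (t *\<^sub>R 1 - h)"
  unfolding spec_nonneg_def by (auto simp: star_simps intro!: exI[of _ t])

text \<open>
  Iteration for \<open>s = (x + s\<^sup>2) / 2\<close>, whose solution gives the square root \<open>1 - s\<close> of \<open>1 - x\<close>.
\<close>

primrec sqrt_iter :: "'a::real_normed_algebra_1 \<Rightarrow> nat \<Rightarrow> 'a" where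
  "sqrt_iter x 0 = 0"
| "sqrt_iter x (Suc n) = (1/2) *\<^sub>R (x + sqrt_iter x n * sqrt_iter x n)"

lemma sqrt_iter_real_bounds: "0 \<le> sqrt_iter (1::real) n \<and> sqrt_iter (1::real) n \<le> 1"
proof (induction n)
  case (Suc n)
  then show ?case by (simp add: mult_le_one)
qed simp

lemma sqrt_iter_real_converges: "convergent (sqrt_iter (1::real))"
proof -
  have "sqrt_iter (1::real) n \<le> sqrt_iter 1 (Suc n)" for n
  proof -
    have "0 \<le> (1 - sqrt_iter (1::real) n)\<^sup>2" by simp
    then show ?thesis by (simp add: power2_eq_square algebra_simps)
  qed
  then have "incseq (sqrt_iter (1::real))" by (rule incseq_SucI)
  then show ?thesis
    using sqrt_iter_real_bounds by (intro Bseq_mono_convergent BseqI'[of _ 1]) (auto dest: incseqD)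
qed

lemma sqrt_iter_commute: "c * x = x * c \<Longrightarrow> c * sqrt_iter x n = sqrt_iter x n * c"
proof (induction n)
  case (Suc n)
  have "c * (s * s) = s * s * c" if "c * s = s * c" for s
    by (metis that mult.assoc)
  with Suc show ?case by (simp add: algebra_simps)
qed simp

lemma sqrt_iter_norm:
  fixes x :: "'a::real_normed_algebra_1"
  assumes "norm x \<le> 1"
  shows "norm (sqrt_iter x n) \<le> sqrt_iter 1 n"
proof (induction n)
  case (Suc n)
  have "norm (sqrt_iter x n * sqrt_iter x n) \<le> sqrt_iter 1 n * sqrt_iter 1 n"
    by (rule order_trans[OF norm_mult_ineq]) (intro mult_mono Suc, use sqrt_iter_real_bounds in auto)
  then have "norm (x + sqrt_iter x n * sqrt_iter x n) \<le> 1 + sqrt_iter 1 n * sqrt_iter 1 n"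
    by (rule norm_triangle_mono[OF assms])
  then show ?case by simp
qed simp

text \<open>
  The increments for \<open>norm x \<le> 1\<close> are dominated by those of the real iteration at \<open>x = 1\<close>, because
  \<open>t\<^sup>2 - s\<^sup>2 = (t - s) (t + s)\<close> for the commuting iterates. The real iteration is increasing and bounded, so the
  increments are summable even in the critical case \<open>norm x = 1\<close>.
\<close>

lemma sqrt_iter_norm_step:
  fixes x :: "'a::real_normed_algebra_1"
  assumes "norm x \<le> 1"
  shows "norm (sqrt_iter x (Suc n) - sqrt_iter x n) \<le> sqrt_iter 1 (Suc n) - sqrt_iter 1 n"
proof (induction n)
  case (Suc n)
  define s t :: 'a where "s = sqrt_iter x n" and "t = sqrt_iter x (Suc n)"
  define \<sigma> \<tau> :: real where "\<sigma> = sqrt_iter 1 n" and "\<tau> = sqrt_iter 1 (Suc n)"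
  have comm: "s * t = t * s"
    unfolding s_def t_def by (intro sqrt_iter_commute sqrt_iter_commute[symmetric] refl)
  have "sqrt_iter x (Suc (Suc n)) - sqrt_iter x (Suc n) = (1/2) *\<^sub>R (t * t) - (1/2) *\<^sub>R (s * s)"
    unfolding sqrt_iter.simps(2)[of x "Suc n"] t_def[symmetric]
    by (simp add: t_def s_def scaleR_add_right)
  also have "\<dots> = (1/2) *\<^sub>R ((t - s) * (t + s))"
    by (simp add: algebra_simps comm)
  finally have "norm (sqrt_iter x (Suc (Suc n)) - sqrt_iter x (Suc n)) = norm ((t - s) * (t + s)) / 2"
    by simp
  moreover have "norm ((t - s) * (t + s)) \<le> (\<tau> - \<sigma>) * (\<tau> + \<sigma>)"
  proof (rule order_trans[OF norm_mult_ineq], rule mult_mono)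
    show "norm (t - s) \<le> \<tau> - \<sigma>" using Suc by (simp only: s_def t_def \<sigma>_def \<tau>_def)
    show "norm (t + s) \<le> \<tau> + \<sigma>"
      unfolding s_def t_def \<sigma>_def \<tau>_def
      by (intro norm_triangle_mono sqrt_iter_norm[OF assms])
    show "0 \<le> \<tau> - \<sigma>" using order_trans[OF norm_ge_zero Suc] by (simp only: \<sigma>_def \<tau>_def)
  qed simp
  moreover have "(\<tau> - \<sigma>) * (\<tau> + \<sigma>) / 2 = sqrt_iter 1 (Suc (Suc n)) - sqrt_iter 1 (Suc n)"
    unfolding sqrt_iter.simps(2)[of 1 "Suc n"] \<tau>_def[symmetric]
    by (simp add: \<tau>_def \<sigma>_def algebra_simps add_divide_distrib diff_divide_distrib)
  ultimately show ?case by linarith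
qed (use assms in simp)

lemma sqrt_one_minus:
  fixes x :: "'a::unital_cstar_algebra"
  assumes x: "star x = x" "norm x \<le> 1"
  obtains y where "star y = y" "y * y = 1 - x" "norm (1 - y) \<le> 1"
    "\<And>c. c * x = x * c \<Longrightarrow> c * y = y * c"
proof -
  have "summable (\<lambda>n. sqrt_iter (1::real) (Suc n) - sqrt_iter 1 n)"
    using sqrt_iter_real_converges unfolding convergent_def by (auto intro: telescope_summable simp del: sqrt_iter.simps)
  then have "summable (\<lambda>n. sqrt_iter x (Suc n) - sqrt_iter x n)"
    by (rule summable_comparison_test'[where N=0]) (rule sqrt_iter_norm_step[OF x(2)])
  then have "convergent (\<lambda>m. \<Sum>n<m. sqrt_iter x (Suc n) - sqrt_iter x n)"
    by (simp only: summable_iff_convergent)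
  then obtain s where s: "sqrt_iter x \<longlonglongrightarrow> s"
    by (auto simp: sum_lessThan_telescope convergent_def simp del: sqrt_iter.simps(2))
  have sa: "star (sqrt_iter x n) = sqrt_iter x n" for n
    by (induction n) (simp_all add: star_simps x)
  show thesis
  proof (rule that[of "1 - s"])
    have "(\<lambda>n. star (sqrt_iter x n)) \<longlonglongrightarrow> star s"
      using s by (rule bounded_linear.tendsto[OF star_bounded_linear])
    then have "star s = s" unfolding sa using s by (rule LIMSEQ_unique)
    then show "star (1 - s) = 1 - s" by (simp add: star_simps)
    have "(\<lambda>n. sqrt_iter x (Suc n)) \<longlonglongrightarrow> (1/2) *\<^sub>R (x + s * s)"
      unfolding sqrt_iter.simps by (intro tendsto_intros s)
    then have "s = (1/2) *\<^sub>R (x + s * s)"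
      by (rule LIMSEQ_unique[OF LIMSEQ_Suc[OF s]])
    then have "2 *\<^sub>R s = 2 *\<^sub>R ((1/2) *\<^sub>R (x + s * s))" by (rule arg_cong)
    then have "s + s = x + s * s"
      by (simp add: scaleR_2)
    then show "(1 - s) * (1 - s) = 1 - x" by (simp add: algebra_simps)
    have "norm s \<le> 1"
      by (rule LIMSEQ_le_const2[OF tendsto_norm[OF s]])
        (use order_trans[OF sqrt_iter_norm[OF x(2)] conjunct2[OF sqrt_iter_real_bounds]] in auto)
    then show "norm (1 - (1 - s)) \<le> 1" by simp
    show "c * (1 - s) = (1 - s) * c" if "c * x = x * c" for c
    proof -
      have "(\<lambda>n. c * sqrt_iter x n) \<longlonglongrightarrow> c * s" "(\<lambda>n. sqrt_iter x n * c) \<longlonglongrightarrow> s * c"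
        by (intro tendsto_intros s)+
      then have "c * s = s * c"
        unfolding sqrt_iter_commute[OF that] by (rule LIMSEQ_unique)
      then show ?thesis by (simp add: algebra_simps)
    qed
  qed
qed

text \<open>
  The root commutes with everything that commutes with \<open>a\<close>, being a limit of polynomials in \<open>a\<close>; this is
  what makes it possible to multiply roots of related elements.
\<close>

lemma spec_nonneg_sqrt:
  fixes a :: "'a::unital_cstar_algebra"
  assumes "spec_nonneg a"
  obtains y where "spec_nonneg y" "y * y = a" "\<And>c. c * a = a * c \<Longrightarrow> c * y = y * c"
proof -
  obtain t where t: "norm (t *\<^sub>R 1 - a) \<le> t" and sa: "star a = a"
    using assms by (auto simp: spec_nonneg_def)
  show thesis
  proof (cases "t = 0")
    case True
    with t have "a = 0" by simp
    with assms show thesis by (intro that[of 0]) auto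
  next
    case False
    with t norm_ge_zero[of "t *\<^sub>R 1 - a"] have t0: "t > 0" by linarith
    define x where "x = 1 - (1/t) *\<^sub>R a"
    have tx: "t *\<^sub>R x = t *\<^sub>R 1 - a" using t0 by (simp add: x_def algebra_simps)
    have "t * norm x \<le> t" using t t0 tx by (metis norm_scaleR abs_of_pos)
    then have nx: "norm x \<le> 1" using t0 by simp
    have sx: "star x = x" by (simp add: x_def star_simps sa)
    obtain y where y: "star y = y" "y * y = 1 - x" "norm (1 - y) \<le> 1"
      "\<And>c. c * x = x * c \<Longrightarrow> c * y = y * c"
      by (rule sqrt_one_minus[OF sx nx]) blast
    show thesis
    proof (rule that[of "sqrt t *\<^sub>R y"])
      have "norm (sqrt t *\<^sub>R 1 - sqrt t *\<^sub>R y) \<le> sqrt t"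
        using y(3) t0 by (simp add: mult_left_le flip: scaleR_diff_right)
      then show "spec_nonneg (sqrt t *\<^sub>R y)"
        unfolding spec_nonneg_def by (auto simp: star_simps y(1))
      show "sqrt t *\<^sub>R y * sqrt t *\<^sub>R y = a"
        using t0 by (simp add: y(2)) (simp add: x_def)
      show "c * sqrt t *\<^sub>R y = sqrt t *\<^sub>R y * c" if "c * a = a * c" for c
        using y(4)[of c] that by (simp add: x_def algebra_simps)
    qed
  qed
qed

text \<open>
  With \<open>t = (norm y)\<^sup>2\<close> the element \<open>t - y\<^sup>2\<close> is nonnegative by definition, so it is a square \<open>z\<^sup>2\<close> with \<open>z\<close>
  commuting with \<open>y\<close>, and \<open>norm_commuting_squares\<close> bounds its norm by \<open>t\<close>.
\<close>

lemma spec_nonneg_square: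
  fixes y :: "'a::unital_cstar_algebra"
  assumes y: "star y = y"
  shows "spec_nonneg (y * y)"
proof -
  define t where "t = (norm y)\<^sup>2"
  have "spec_nonneg (t *\<^sub>R 1 - y * y)"
    by (rule spec_nonneg_scalar_minus) (simp_all add: t_def y star_simps norm_square_selfadjoint)
  then obtain z where z: "spec_nonneg z" "z * z = t *\<^sub>R 1 - y * y"
    and c: "\<And>c. c * (t *\<^sub>R 1 - y * y) = (t *\<^sub>R 1 - y * y) * c \<Longrightarrow> c * z = z * c"
    by (rule spec_nonneg_sqrt) blast
  have sz: "star z = z" using z(1) by (simp add: spec_nonneg_def)
  have "y * z = z * y" by (rule c) (simp add: algebra_simps)
  then have "(norm z)\<^sup>2 \<le> norm (z * z + y * y)"
    by (intro norm_commuting_squares sz y) simp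
  also have "\<dots> = t" by (simp add: z(2) t_def)
  finally have "norm (z * z) \<le> t" by (simp add: norm_square_selfadjoint[OF sz])
  then have "norm (t *\<^sub>R 1 - y * y) \<le> t" by (simp add: z(2))
  then show ?thesis unfolding spec_nonneg_def by (auto simp: star_simps y)
qed

text \<open>
  \<open>a\<close> and \<open>t - a\<close> are squares of commuting elements whose squares sum to \<open>t\<close>.
\<close>

lemma spec_nonneg_norm_le_scalar:
  fixes a :: "'a::unital_cstar_algebra"
  assumes "spec_nonneg a" "spec_nonneg (t *\<^sub>R 1 - a)"
  shows "norm a \<le> \<bar>t\<bar>"
proof -
  obtain y where y: "spec_nonneg y" "y * y = a" and cy: "\<And>c. c * a = a * c \<Longrightarrow> c * y = y * c"
    by (rule spec_nonneg_sqrt[OF assms(1)]) blast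
  obtain z where z: "spec_nonneg z" "z * z = t *\<^sub>R 1 - a"
    and cz: "\<And>c. c * (t *\<^sub>R 1 - a) = (t *\<^sub>R 1 - a) * c \<Longrightarrow> c * z = z * c"
    by (rule spec_nonneg_sqrt[OF assms(2)]) blast
  have s: "star y = y" "star z = z" using y z by (auto simp: spec_nonneg_def)
  have "y * a = a * y" using y(2) mult.assoc by metis
  then have "y * z = z * y" by (intro cz) (simp add: algebra_simps)
  then have "(norm y)\<^sup>2 \<le> norm (y * y + z * z)" by (intro norm_commuting_squares s)
  then show ?thesis using norm_square_selfadjoint[OF s(1)] by (simp add: y z)
qed

lemma spec_nonneg_norm_mono:
  fixes a b :: "'a::unital_cstar_algebra"
  assumes "spec_nonneg a" "spec_nonneg (b - a)"
  shows "norm a \<le> norm b"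
proof -
  have "star a = a" "star (b - a) = b - a" using assms by (auto simp: spec_nonneg_def)
  then have "star b = b" by (simp add: star_simps)
  then have "spec_nonneg (norm b *\<^sub>R 1 - b)" by (intro spec_nonneg_scalar_minus) auto
  from spec_nonneg_add[OF this assms(2)] have "spec_nonneg (norm b *\<^sub>R 1 - a)" by simp
  from spec_nonneg_norm_le_scalar[OF assms(1) this] show ?thesis by simp
qed

section \<open>Positivity of all elements star x * x\<close>

text \<open>
  Let \<open>a = - (star z * z)\<close> be nonnegative and \<open>t = (norm z)\<^sup>2 = norm a\<close>. Then \<open>z * star z\<close> is nonnegative of
  norm \<open>t\<close>, so \<open>(t - z * star z) * z = z * (t + a)\<close> has norm at most \<open>t * norm z\<close>; squaring, the norm of
  \<open>a (t + a)\<^sup>2\<close> is at most \<open>t\<^sup>3\<close>. But \<open>a (t + a)\<^sup>2 \<ge> 2 t a\<^sup>2\<close> has norm at least \<open>2 t\<^sup>3\<close>. Hence \<open>t = 0\<close>.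
\<close>

lemma spec_nonneg_star_mult_neg_imp_zero:
  fixes z :: "'a::unital_cstar_algebra"
  assumes neg: "spec_nonneg (- (star z * z))"
  shows "z = 0"
proof -
  define a t where "a = - (star z * z)" and "t = (norm z)\<^sup>2"
  have sa: "star a = a" by (simp add: a_def star_simps)
  have a: "spec_nonneg a" using neg by (simp add: a_def)
  have na: "norm a = t" by (simp add: a_def t_def cstar_identity)
  \<comment> \<open>With real and imaginary parts \<open>h\<close> and \<open>k\<close> of \<open>z\<close>, the sum of \<open>star z * z\<close> and \<open>z * star z\<close> is
    \<open>2 h\<^sup>2 + 2 k\<^sup>2\<close>, so \<open>z * star z\<close> is a sum of three nonnegative elements.\<close>
  define h k where "h = (1/2) *\<^sub>R (z + star z)" and "k = (- \<i> / 2) *\<^sub>C (z - star z)"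
  have hk: "star h = h" "star k = k"
    by (simp_all add: h_def k_def star_simps add.commute scaleC_diff_right scaleC_minus_left)
  have kk: "k * k = - ((1/4) *\<^sub>R ((z - star z) * (z - star z)))"
    by (simp add: k_def mult_scaleC_left mult_scaleC_right scaleC_scaleC scaleR_scaleC scaleC_minus_left
        scaleC_minus_right)
  have "z * star z = 2 *\<^sub>R (h * h) + 2 *\<^sub>R (k * k) + a"
    by (simp add: kk a_def) (simp add: h_def algebra_simps flip: scaleR_add_left)
  also have "spec_nonneg \<dots>"
    by (intro spec_nonneg_add spec_nonneg_scaleR spec_nonneg_square hk a) auto
  finally have "spec_nonneg (z * star z)" .
  moreover have nzz: "norm (z * star z) = t"
    using cstar_identity[of "star z"] by (simp add: t_def star_star norm_star)
  moreover have "spec_nonneg (t *\<^sub>R 1 - z * star z)"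
    by (rule spec_nonneg_scalar_minus) (simp_all add: star_simps nzz)
  ultimately have "norm (t *\<^sub>R 1 - z * star z) \<le> norm (t *\<^sub>R (1::'a))"
    by (intro spec_nonneg_norm_mono) auto
  then have n1: "norm (t *\<^sub>R 1 - z * star z) \<le> t" by (simp add: t_def)
  \<comment> \<open>\<open>z\<close> intertwines \<open>star z * z = - a\<close> with \<open>z * star z\<close>, which gives two expressions for \<open>y\<close>:
    one bounds its norm from above, the other from below.\<close>
  define y where "y = z * (t *\<^sub>R 1 + a)"
  have "y = (t *\<^sub>R 1 - z * star z) * z"
    by (simp add: y_def a_def algebra_simps)
  then have "norm y \<le> t * norm z"
    using n1 by (metis mult_right_mono norm_ge_zero norm_mult_ineq order_trans)
  then have "(norm y)\<^sup>2 \<le> (t * norm z)\<^sup>2" by (intro power_mono) auto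
  then have ny: "(norm y)\<^sup>2 \<le> t ^ 3" by (simp add: power_mult_distrib t_def power_numeral_reduce)
  have yy: "star y * y = - ((t *\<^sub>R 1 + a) * a * (t *\<^sub>R 1 + a))"
    by (simp add: y_def star_simps sa mult.assoc)  (simp add: a_def mult.assoc)
  obtain r where r: "spec_nonneg r" "r * r = a" by (rule spec_nonneg_sqrt[OF a]) blast
  have "star r = r" using r by (simp add: spec_nonneg_def)
  then have aaa: "spec_nonneg (a * a * a)"
    using spec_nonneg_square[of "r * r * r"] by (simp add: star_simps mult.assoc flip: r(2))
  have "spec_nonneg ((t * t) *\<^sub>R a + a * a * a)"
    by (intro spec_nonneg_add spec_nonneg_scaleR a aaa) simp
  also have "(t * t) *\<^sub>R a + a * a * a = - (star y * y) - (2 * t) *\<^sub>R (a * a)"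
    by (simp add: yy algebra_simps flip: scaleR_2)
  finally have "norm ((2 * t) *\<^sub>R (a * a)) \<le> norm (- (star y * y))"
    by (intro spec_nonneg_norm_mono spec_nonneg_scaleR spec_nonneg_square sa) (simp add: t_def)
  then have "2 * t * t\<^sup>2 \<le> t ^ 3"
    using ny by (simp add: norm_square_selfadjoint[OF sa] na cstar_identity t_def)
  then have "t ^ 3 \<le> 0" by (simp add: power_numeral_reduce)
  then show ?thesis by (simp add: t_def power_le_zero_eq)
qed

text \<open>
  The theorem of Fukamiya, Kelley and Vaught. With \<open>a = star x * x\<close>, \<open>s\<close> the root of \<open>a\<^sup>2\<close> and \<open>n = s - a\<close>, the
  element \<open>z = x * n\<close> has \<open>star z * z = n a n = - n s n\<close>, which is nonpositive; so \<open>z = 0\<close> by the previous lemma,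
  and this forces \<open>n = 0\<close>, that is \<open>a = s\<close>.
\<close>

lemma spec_nonneg_star_mult:
  fixes x :: "'a::unital_cstar_algebra"
  shows "spec_nonneg (star x * x)"
proof -
  define a where "a = star x * x"
  have sa: "star a = a" by (simp add: a_def star_simps)
  obtain s where s: "spec_nonneg s" "s * s = a * a"
    and cs: "\<And>c. c * (a * a) = (a * a) * c \<Longrightarrow> c * s = s * c"
    by (rule spec_nonneg_sqrt[OF spec_nonneg_square[OF sa]]) blast
  have as: "a * s = s * a" by (rule cs) (simp add: mult.assoc)
  obtain r where r: "spec_nonneg r" "r * r = s"
    and cr: "\<And>c. c * s = s * c \<Longrightarrow> c * r = r * c"
    by (rule spec_nonneg_sqrt[OF s(1)]) blast
  have ar: "a * r = r * a" by (rule cr[OF as])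
  have ss: "star s = s" "star r = r" using s r by (auto simp: spec_nonneg_def)
  have sr: "s * r = r * s" using r(2) by (metis mult.assoc)
  \<comment> \<open>\<open>s\<close> is the absolute value of \<open>a\<close>, and \<open>n\<close> is twice its negative part.\<close>
  define n where "n = s - a"
  have sn: "star n = n" by (simp add: n_def star_simps ss sa)
  have nr: "n * r = r * n" by (simp add: n_def algebra_simps ar sr)
  have na: "n * a = - (n * s)" by (simp add: n_def algebra_simps s(2) as)
  have nan: "star (x * n) * (x * n) = - (n * s * n)"
  proof -
    have "star (x * n) * (x * n) = n * a * n" by (simp add: star_simps sn a_def mult.assoc)
    also have "\<dots> = - (n * s * n)" by (simp only: na) simp
    finally show ?thesis .
  qed
  have "n * s * n = (n * r) * (n * r)" by (metis r(2) nr mult.assoc)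
  then have "spec_nonneg (- (star (x * n) * (x * n)))"
    using spec_nonneg_square[of "n * r"] unfolding nan by (simp add: star_simps sn ss nr)
  then have "x * n = 0" by (rule spec_nonneg_star_mult_neg_imp_zero)
  then have an: "a * n = 0" by (simp add: a_def mult.assoc)
  have "n * n = 2 *\<^sub>R (a * a) - 2 *\<^sub>R (a * s)" by (simp add: n_def algebra_simps s(2) as scaleR_2)
  also have "\<dots> = - (2 *\<^sub>R (a * n))" by (simp add: n_def algebra_simps)
  finally have "n * n = 0" using an by simp
  then have "n = 0" using norm_square_selfadjoint[OF sn] by simp
  then show ?thesis using s(1) by (simp add: n_def a_def)
qed

lemma positive_iff_spec_nonneg: "positive a \<longleftrightarrow> spec_nonneg a"
proof
  assume "spec_nonneg a"
  then obtain y where "spec_nonneg y" "y * y = a"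
    by (rule spec_nonneg_sqrt) blast
  then have "a = star y * y" by (simp add: spec_nonneg_def)
  then show "positive a"
    unfolding positive_def by (rule exI)
qed (auto simp: positive_def spec_nonneg_star_mult)

section \<open>The order\<close>

lemma positive_star_mult: "positive (star x * x)"
  by (auto simp: positive_def)

lemma positive_mult_star: "positive (x * star x)"
  using positive_star_mult[of "star x"] by (simp add: star_star)

lemma positive_selfadjoint: "positive a \<Longrightarrow> star a = a"
  by (simp add: positive_iff_spec_nonneg spec_nonneg_def)

lemma positive_add: "positive a \<Longrightarrow> positive b \<Longrightarrow> positive (a + b)"
  by (simp add: positive_iff_spec_nonneg spec_nonneg_add)

lemma positive_scaleR: "positive a \<Longrightarrow> 0 \<le> r \<Longrightarrow> positive (r *\<^sub>R a)"
  by (simp add: positive_iff_spec_nonneg spec_nonneg_scaleR)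

lemma positive_scalar: "0 \<le> r \<Longrightarrow> positive (r *\<^sub>R 1)"
  using positive_star_mult[of 1] by (intro positive_scaleR) (simp_all add: star_one)

lemma positive_conj:
  assumes "positive a" shows "positive (star c * a * c)" and "positive (c * a * star c)"
proof -
  have "positive (star d * a * d)" for d
    using assms positive_star_mult by (metis positive_def mult.assoc star_mult)
  from this[of c] this[of "star c"]
  show "positive (star c * a * c)" "positive (c * a * star c)" by (simp_all add: star_star)
qed

lemma positive_scalar_minus: "star h = h \<Longrightarrow> norm h \<le> t \<Longrightarrow> positive (t *\<^sub>R 1 - h)"
  by (simp add: positive_iff_spec_nonneg spec_nonneg_scalar_minus)

lemma positive_norm_mono: "positive a \<Longrightarrow> positive (b - a) \<Longrightarrow> norm a \<le> norm b"
  by (simp add: positive_iff_spec_nonneg spec_nonneg_norm_mono)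

lemma positive_antisym: "positive a \<Longrightarrow> positive (- a) \<Longrightarrow> a = 0"
  using positive_norm_mono[of a 0] by simp

section \<open>Imaginary parts and the half-planes\<close>

lemma Im_part_bounded_linear: "bounded_linear (Im_part :: 'a \<Rightarrow> 'a::unital_cstar_algebra)"
  unfolding Im_part_def
  by (intro bounded_linear_compose[OF scaleC_bounded_linear] bounded_linear_sub
      bounded_linear_ident star_bounded_linear)

lemmas Im_part_linear = Im_part_bounded_linear[THEN bounded_linear.linear]
lemmas Im_part_diff = linear_diff[OF Im_part_linear]

lemma star_Im_part: "star (Im_part b) = Im_part b"
proof -
  have "star (Im_part b) = (- (1 / (2 * \<i>))) *\<^sub>C (star b - b)"
    by (simp add: Im_part_def star_simps)
  also have "\<dots> = Im_part b"
    unfolding scaleC_minus_left scaleC_minus_right[symmetric] by (simp add: Im_part_def)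
  finally show ?thesis .
qed

lemma Im_part_star: "Im_part (star b) = - Im_part b"
  by (simp add: Im_part_def star_star flip: scaleC_minus_right)

lemma norm_Im_part: "norm (Im_part b) \<le> norm b"
proof -
  have "norm (Im_part b) = norm (b - star b) / 2"
    by (simp add: Im_part_def norm_scaleC norm_divide norm_mult)
  also have "\<dots> \<le> (norm b + norm (star b)) / 2"
    by (intro divide_right_mono norm_triangle_ineq4) simp
  finally show ?thesis by (simp add: norm_star)
qed

lemma Im_part_conj: "Im_part (c * a * star c) = c * Im_part a * star c"
  by (simp add: Im_part_def star_simps mult_scaleC_left mult_scaleC_right algebra_simps)

lemma cartesian_decomposition: "b = Im_part (\<i> *\<^sub>C b) + \<i> *\<^sub>C Im_part b"
  by (simp add: Im_part_def star_simps scaleC_scaleC scaleC_diff_right scaleC_add_right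
      scaleC_minus_left scaleC_minus_right scaleC_one flip: scaleC_add_left)

text \<open>
  The imaginary part of \<open>c * g * star c = 0\<close> is \<open>c * Im_part g * star c\<close>, which is bounded above by
  \<open>- \<epsilon> *\<^sub>R (c * star c)\<close>.
\<close>

lemma lower_half_left_cancel:
  assumes g: "g \<in> lower_half" and cg: "c * g = 0"
  shows "c = 0"
proof -
  obtain \<epsilon> where \<epsilon>: "\<epsilon> > 0" and pos: "positive (- Im_part g - \<epsilon> *\<^sub>R 1)"
    using g by (auto simp: lower_half_def cstar_le_def)
  have "c * Im_part g * star c = 0"
    using Im_part_conj[of c g] by (simp add: cg linear_0[OF Im_part_linear])
  then have "c * (- Im_part g - \<epsilon> *\<^sub>R 1) * star c = - (\<epsilon> *\<^sub>R (c * star c))"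
    by (simp add: algebra_simps)
  then have "\<epsilon> *\<^sub>R (c * star c) = 0"
    using positive_conj(2)[OF pos, of c] \<epsilon>
    by (intro positive_antisym positive_scaleR positive_mult_star) auto
  then show ?thesis
    using \<epsilon> cstar_identity[of "star c"] by (simp add: star_star norm_star)
qed

text \<open>
  The equation makes \<open>1 - g * w\<close> a left annihilator of \<open>g\<close>. Thus the Dyson equation, which only provides a
  one-sided inverse of \<open>g\<close>, makes \<open>g\<close> invertible.
\<close>

lemma lower_half_left_inverse:
  assumes "g \<in> lower_half" "w * g = 1"
  shows "g * w = 1"
proof -
  have "(1 - g * w) * g = 0" by (simp add: left_diff_distrib mult.assoc assms(2))
  from lower_half_left_cancel[OF assms(1) this] show ?thesis by simp
qed

section \<open>Neumann series of operators with geometrically decaying powers\<close>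

lemma linear_funpow:
  fixes f :: "'b::real_normed_vector \<Rightarrow> 'b"
  assumes "linear f" shows "linear (f ^^ n)"
proof (induction n)
  case 0
  show ?case using bounded_linear.linear[OF bounded_linear_ident] by (simp add: id_def)
next
  case (Suc n)
  from linear_compose[OF Suc assms] show ?case by (simp add: o_def)
qed

definition neumann :: "('b::banach \<Rightarrow> 'b) \<Rightarrow> 'b \<Rightarrow> 'b" where
  "neumann M r = (\<Sum>n. (M ^^ n) r)"

locale geometric_powers =
  fixes M :: "'b::banach \<Rightarrow> 'b" and \<kappa> q :: real
  assumes bounded_linear: "bounded_linear M"
    and q: "0 \<le> q" "q < 1"
    and norm_power: "norm ((M ^^ n) x) \<le> \<kappa> * q ^ n * norm x"
begin

lemma power_linear: "linear (M ^^ n)"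
  by (rule linear_funpow[OF bounded_linear.linear[OF bounded_linear]])

lemma summable_bound: "summable (\<lambda>n. \<kappa> * q ^ n * norm x)"
  using q by (intro summable_mult summable_mult2 summable_geometric) auto

lemma summable_powers: "summable (\<lambda>n. (M ^^ n) x)"
  by (rule summable_comparison_test'[OF summable_bound[of x], where N=0]) (rule norm_power)

lemma neumann_norm: "norm (neumann M x) \<le> \<kappa> / (1 - q) * norm x"
proof -
  have sn: "summable (\<lambda>n. norm ((M ^^ n) x))"
    by (rule summable_comparison_test'[OF summable_bound[of x], where N=0]) (simp add: norm_power)
  have "norm (neumann M x) \<le> (\<Sum>n. norm ((M ^^ n) x))"
    unfolding neumann_def by (rule summable_norm[OF sn])
  also have "\<dots> \<le> (\<Sum>n. \<kappa> * q ^ n * norm x)"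
    by (rule suminf_le[OF norm_power sn summable_bound])
  also have "\<dots> = \<kappa> / (1 - q) * norm x"
    using q by (simp add: suminf_mult suminf_mult2[symmetric] suminf_geometric summable_geometric summable_mult)
  finally show ?thesis .
qed

lemma neumann_bounded_linear: "bounded_linear (neumann M)"
proof (rule bounded_linear_intro)
  show "neumann M (x + y) = neumann M x + neumann M y" for x y
    by (simp add: neumann_def linear_add[OF power_linear] suminf_add summable_powers)
  show "neumann M (r *\<^sub>R x) = r *\<^sub>R neumann M x" for r x
    by (simp add: neumann_def linear_cmul[OF power_linear] suminf_scaleR_right summable_powers)
  show "norm (neumann M x) \<le> norm x * (\<kappa> / (1 - q))" for x
    using neumann_norm[of x] by (simp add: mult.commute)
qed

lemma neumann_fixed_point: "neumann M r = r + M (neumann M r)"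
proof -
  have "M (neumann M r) = (\<Sum>n. (M ^^ Suc n) r)"
    by (simp add: neumann_def bounded_linear.suminf[OF bounded_linear summable_powers])
  also have "\<dots> = neumann M r - r"
    by (simp only: neumann_def suminf_split_head[OF summable_powers] funpow_0)
  finally show ?thesis by simp
qed

lemma fixed_point_eq_neumann:
  assumes f: "f = r + M f"
  shows "f = neumann M r"
proof -
  define d where "d = f - neumann M r"
  have "M f = f - r" "M (neumann M r) = neumann M r - r"
    using f neumann_fixed_point[of r] by (metis add_diff_cancel_left')+
  then have "M d = d"
    by (simp add: d_def linear_diff[OF bounded_linear.linear[OF bounded_linear]])
  then have "(M ^^ n) d = d" for n by (induction n) auto
  then have "(\<lambda>n. d) \<longlonglongrightarrow> 0" using summable_LIMSEQ_zero[OF summable_powers[of d]] by simp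
  then have "d = 0" by (simp add: LIMSEQ_const_iff)
  then show ?thesis by (simp add: d_def)
qed

lemma fixed_point_norm: "f = r + M f \<Longrightarrow> norm f \<le> \<kappa> / (1 - q) * norm r"
  using neumann_norm fixed_point_eq_neumann by metis

end

section \<open>Positive matrices\<close>

lemma positive_mat_iff:
  "positive_mat A \<longleftrightarrow> (\<exists>X :: 'a::unital_cstar_algebra ^ 2 ^ 2. \<forall>i j. A $ i $ j = star (X $ 1 $ i) * X $ 1 $ j + star (X $ 2 $ i) * X $ 2 $ j)"
  unfolding positive_mat_def
  by (simp add: vec_eq_iff star_mat_def matrix_matrix_mult_def sum_2)

lemma positive_matI:
  fixes X :: "'a::unital_cstar_algebra ^ 2 ^ 2"
  assumes "\<And>i j. A $ i $ j = star (X $ 1 $ i) * X $ 1 $ j + star (X $ 2 $ i) * X $ 2 $ j"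
  shows "positive_mat A"
  using assms unfolding positive_mat_iff by (intro exI[of _ X]) simp

lemma positive_mat_diagonal: "positive_mat A \<Longrightarrow> positive (A $ i $ i)"
  unfolding positive_mat_iff by (auto intro!: positive_add positive_star_mult)

text \<open>
  The matrix is \<open>X* X\<close> for the upper triangular \<open>X\<close> with rows \<open>(1, x)\<close> and \<open>(0, y)\<close>, where \<open>y\<close> is a root of
  \<open>1 - star x * x\<close>.
\<close>

lemma positive_mat_unit_corner:
  fixes x :: "'a::unital_cstar_algebra"
  assumes "norm x \<le> 1"
  shows "positive_mat (\<chi> i j. if i = j then 1 else if i = 1 then x else star x :: 'a ^ 2 ^ 2)"
proof -
  have "positive (1 *\<^sub>R 1 - star x * x)"
    using assms by (intro positive_scalar_minus) (auto simp: star_simps cstar_identity power_le_one)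
  then obtain y where y: "1 - star x * x = star y * y" by (auto simp: positive_def)
  then have "star x * x + star y * y = 1" by (metis add.commute diff_add_cancel)
  then show ?thesis
    by (intro positive_matI[where X = "\<chi> i j. if i = 1 then (if j = 1 then 1 else x) else (if j = 1 then 0 else y)"])
       (use exhaust_2 in \<open>auto simp: star_simps\<close>)
qed

text \<open>
  The Schur complement \<open>\<beta> - x* x / \<alpha>\<close> of the corner \<open>x\<close> is positive, since a positive matrix gives positive
  values on the vector \<open>(- x / \<alpha>, 1)\<close>.
\<close>

lemma positive_mat_Cauchy_Schwarz:
  fixes A :: "'a::unital_cstar_algebra ^ 2 ^ 2"
  assumes A: "positive_mat A" and \<alpha>: "\<alpha> > 0" "positive (\<alpha> *\<^sub>R 1 - A $ 1 $ 1)"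
    and \<beta>: "\<beta> \<ge> 0" "positive (\<beta> *\<^sub>R 1 - A $ 2 $ 2)"
  shows "(norm (A $ 1 $ 2))\<^sup>2 \<le> \<alpha> * \<beta>"
proof -
  obtain X :: "'a ^ 2 ^ 2" where X: "\<And>i j. A $ i $ j = star (X $ 1 $ i) * X $ 1 $ j + star (X $ 2 $ i) * X $ 2 $ j"
    using A unfolding positive_mat_iff by blast
  define p q r s where "p = X $ 1 $ 1" and "q = X $ 1 $ 2" and "r = X $ 2 $ 1" and "s = X $ 2 $ 2"
  define a x b where "a = A $ 1 $ 1" and "x = A $ 1 $ 2" and "b = A $ 2 $ 2"
  note defs = p_def q_def r_def s_def a_def x_def b_def
  have a: "a = star p * p + star r * r" and x: "x = star p * q + star r * s"
    and b: "b = star q * q + star s * s"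
    by (simp_all add: defs X)
  have sx: "star x = star q * p + star s * r" by (simp add: x star_simps)
  define t where "t = 1 / \<alpha>"
  have t: "t > 0" "t * \<alpha> = 1" using \<alpha> by (simp_all add: t_def)
  \<comment> \<open>\<open>(v, w)\<close> is the second column of \<open>X\<close> minus the first column times \<open>x / \<alpha>\<close>; its square is the Schur complement
    up to the slack in \<open>a \<le> \<alpha>\<close> and \<open>b \<le> \<beta>\<close>.\<close>
  define v w where "v = q - t *\<^sub>R (p * x)" and "w = s - t *\<^sub>R (r * x)"
  have "star v * v + star w * w = b - t *\<^sub>R (star x * x) - t *\<^sub>R (star x * x) + (t * t) *\<^sub>R (star x * a * x)"
  proof -
    have "star v * v + star w * w = (star q * q + star s * s) - t *\<^sub>R ((star q * p + star s * r) * x)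
        - t *\<^sub>R (star x * (star p * q + star r * s))
        + (t * t) *\<^sub>R (star x * (star p * p + star r * r) * x)"
      by (simp add: v_def w_def star_simps algebra_simps)
    then show ?thesis by (simp only: a[symmetric] x[symmetric] b[symmetric] sx[symmetric])
  qed
  moreover have "star x * (\<alpha> *\<^sub>R 1 - a) * x = \<alpha> *\<^sub>R (star x * x) - star x * a * x"
    by (simp add: algebra_simps)
  moreover have "(t * t) *\<^sub>R (\<alpha> *\<^sub>R (star x * x)) = t *\<^sub>R (star x * x)"
    using t by (simp add: mult.assoc)
  ultimately have "\<beta> *\<^sub>R 1 - t *\<^sub>R (star x * x) = (star v * v + star w * w)
      + (t * t) *\<^sub>R (star x * (\<alpha> *\<^sub>R 1 - a) * x) + (\<beta> *\<^sub>R 1 - b)"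
    by (simp add: scaleR_diff_right)
  also have "positive \<dots>"
    using t \<alpha> \<beta> unfolding a_def b_def
    by (intro positive_add positive_star_mult positive_scaleR positive_conj) auto
  finally have "norm (t *\<^sub>R (star x * x)) \<le> norm (\<beta> *\<^sub>R (1::'a))"
    using t by (intro positive_norm_mono positive_scaleR positive_star_mult) auto
  then have "t * (norm x)\<^sup>2 \<le> \<beta>" using t \<beta> by (simp add: cstar_identity)
  then show ?thesis using \<alpha> by (simp add: t_def x_def field_simps)
qed

section \<open>Two-positive maps and sandwich operators\<close>

lemma two_positive_maps_amplify:
  "\<eta> \<in> two_positive_maps \<Longrightarrow> positive_mat A \<Longrightarrow> positive_mat (\<chi> i j. \<eta> (A $ i $ j))"
  by (auto simp: two_positive_maps_def amplify_def)

lemma two_positive_maps_scaleC: "\<eta> \<in> two_positive_maps \<Longrightarrow> \<eta> (c *\<^sub>C x) = c *\<^sub>C \<eta> x"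
  by (auto simp: two_positive_maps_def clinear_ops_def)

lemma two_positive_maps_positive:
  fixes a :: "'a::unital_cstar_algebra"
  assumes \<eta>: "\<eta> \<in> two_positive_maps" and "positive a"
  shows "positive (\<eta> a)"
proof -
  obtain x where x: "a = star x * x" using assms by (auto simp: positive_def)
  have "positive_mat (\<chi> i j. if i = 1 \<and> j = 1 then a else 0 :: 'a ^ 2 ^ 2)"
    by (rule positive_matI[where X = "\<chi> i j. if i = 1 \<and> j = 1 then x else 0"])
       (auto simp: x star_zero)
  from positive_mat_diagonal[OF two_positive_maps_amplify[OF \<eta> this], of 1]
  show ?thesis by simp
qed

text \<open>
  A self-adjoint element is a difference of two positive ones, namely \<open>norm a\<close> and \<open>norm a - a\<close>.
\<close>

lemma two_positive_maps_selfadjoint: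
  assumes \<eta>: "\<eta> \<in> two_positive_maps" and a: "star a = a"
  shows "star (\<eta> a) = \<eta> a"
proof -
  define t where "t = norm a"
  have "positive (\<eta> (t *\<^sub>R 1 - a))" "positive (\<eta> (t *\<^sub>R 1))"
    by (intro two_positive_maps_positive[OF \<eta>] positive_scalar_minus positive_scalar; simp add: a t_def)+
  then have "star (\<eta> (t *\<^sub>R 1 - a)) = \<eta> (t *\<^sub>R 1 - a)" "star (\<eta> (t *\<^sub>R 1)) = \<eta> (t *\<^sub>R 1)"
    by (simp_all only: positive_selfadjoint)
  then show ?thesis by (simp add: blinfun.diff_right star_diff)
qed

lemma two_positive_maps_Im_part:
  assumes \<eta>: "\<eta> \<in> two_positive_maps"
  shows "Im_part (\<eta> x) = \<eta> (Im_part x)"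
proof -
  define h k where "h = Im_part (\<i> *\<^sub>C x)" and "k = Im_part x"
  have "star (\<eta> h) = \<eta> h" "star (\<eta> k) = \<eta> k"
    by (intro two_positive_maps_selfadjoint[OF \<eta>]; simp add: h_def k_def star_Im_part)+
  moreover have "x = h + \<i> *\<^sub>C k" unfolding h_def k_def by (rule cartesian_decomposition)
  then have "\<eta> x = \<eta> h + \<i> *\<^sub>C \<eta> k" by (simp add: blinfun.add_right two_positive_maps_scaleC[OF \<eta>])
  ultimately have "Im_part (\<eta> x) = (1 / (2 * \<i>)) *\<^sub>C (\<i> *\<^sub>C \<eta> k + \<i> *\<^sub>C \<eta> k)"
    by (simp add: Im_part_def star_simps scaleC_minus_left)
  also have "\<dots> = \<eta> k"
    by (simp add: scaleC_scaleC scaleC_add_right scaleC_one flip: scaleC_add_left)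
  finally show ?thesis by (simp add: k_def)
qed

text \<open>
  For \<open>p = g1\<close>, \<open>q = g0\<close> this is the operator in the linear equation for the difference of the two elements
  \<open>b - \<eta> g\<close>. If \<open>q = star p\<close>, it preserves positivity.
\<close>

definition sandwich :: "('a::unital_cstar_algebra \<Rightarrow>\<^sub>L 'a) \<Rightarrow> 'a \<Rightarrow> 'a \<Rightarrow> 'a \<Rightarrow> 'a" where
  "sandwich \<eta> p q x = \<eta> (p * x * q)"

lemma sandwich_bounded_linear: "bounded_linear (sandwich \<eta> p q)"
  unfolding sandwich_def
  by (intro bounded_linear_compose[OF blinfun.bounded_linear_right]
      bounded_linear_compose[OF bounded_linear_mult_left] bounded_linear_mult_right)

text \<open>
  Conjugating a positive matrix by \<open>diag (d 1, d 2)\<close> and applying \<open>\<eta>\<close> entrywise preserves positivity. Iterating,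
  the mixed sandwich in the corner is tied to the two positive ones on the diagonal.
\<close>

lemma sandwich_powers_positive_mat:
  fixes A :: "'a::unital_cstar_algebra ^ 2 ^ 2"
  assumes \<eta>: "\<eta> \<in> two_positive_maps" and A: "positive_mat A"
  shows "positive_mat (\<chi> i j. (sandwich \<eta> (star (d i)) (d j) ^^ n) (A $ i $ j))"
proof (induction n)
  case 0
  then show ?case using A by simp
next
  case (Suc n)
  define B where "B = (\<chi> i j. (sandwich \<eta> (star (d i)) (d j) ^^ n) (A $ i $ j))"
  obtain X :: "'a ^ 2 ^ 2" where X: "\<And>i j. B $ i $ j = star (X $ 1 $ i) * X $ 1 $ j + star (X $ 2 $ i) * X $ 2 $ j"
    using Suc unfolding B_def[symmetric] positive_mat_iff by blast
  have "positive_mat (\<chi> i j. star (d i) * B $ i $ j * d j)"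
    by (rule positive_matI[where X = "\<chi> k i. X $ k $ i * d i"])
       (simp add: X star_simps algebra_simps)
  from two_positive_maps_amplify[OF \<eta> this] show ?case
    by (simp add: B_def flip: sandwich_def)
qed

lemma sandwich_powers_linear: "linear (sandwich \<eta> p q ^^ n)"
  by (rule linear_funpow[OF bounded_linear.linear[OF sandwich_bounded_linear]])

lemma sandwich_positive:
  assumes "\<eta> \<in> two_positive_maps" "positive a"
  shows "positive (sandwich \<eta> p (star p) a)"
  unfolding sandwich_def by (intro two_positive_maps_positive positive_conj assms)

lemma sandwich_powers_positive:
  assumes "\<eta> \<in> two_positive_maps" "positive a"
  shows "positive ((sandwich \<eta> p (star p) ^^ n) a)"
  by (induction n) (simp_all add: assms sandwich_positive)

text \<open>
  An element \<open>u\<close> between \<open>\<gamma>\<close> and \<open>\<kappa> \<gamma>\<close> that the positive operator lowers by at least \<open>\<gamma>\<close> serves as a strictly positive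
  approximate eigenvector for the factor \<open>1 - 1 / \<kappa>\<close>.
\<close>

lemma sandwich_powers_dominated:
  fixes u :: "'a::unital_cstar_algebra"
  assumes \<eta>: "\<eta> \<in> two_positive_maps" and \<gamma>: "\<gamma> > 0" and \<kappa>: "\<kappa> \<ge> 1"
    and ge: "positive (u - \<gamma> *\<^sub>R 1)" and le: "positive ((\<kappa> * \<gamma>) *\<^sub>R 1 - u)"
    and S: "positive (u - \<gamma> *\<^sub>R 1 - sandwich \<eta> p (star p) u)"
  shows "positive ((\<kappa> * (1 - 1 / \<kappa>) ^ n) *\<^sub>R 1 - (sandwich \<eta> p (star p) ^^ n) 1)"
proof -
  let ?S = "sandwich \<eta> p (star p)"
  define q where "q = 1 - 1 / \<kappa>"
  have q: "q \<ge> 0" using \<kappa> by (simp add: q_def)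
  note lin = bounded_linear.linear[OF sandwich_bounded_linear] and linp = sandwich_powers_linear
  \<comment> \<open>Since \<open>u \<le> \<kappa> \<gamma>\<close>, subtracting \<open>\<gamma>\<close> from \<open>u\<close> is at least as good as multiplying by \<open>q\<close>.\<close>
  have "positive ((1/\<kappa>) *\<^sub>R ((\<kappa> * \<gamma>) *\<^sub>R 1 - u))"
    using \<kappa> by (intro positive_scaleR le) auto
  from positive_add[OF S this] have contr: "positive (q *\<^sub>R u - ?S u)"
    using \<kappa> by (simp add: q_def algebra_simps)
  have A: "positive (q ^ n *\<^sub>R u - (?S ^^ n) u)" for n
  proof (induction n)
    case (Suc n)
    have "positive (q ^ n *\<^sub>R (q *\<^sub>R u - ?S u) + ?S (q ^ n *\<^sub>R u - (?S ^^ n) u))"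
      using q by (intro positive_add positive_scaleR contr sandwich_positive \<eta> Suc) auto
    then show ?case
      by (simp add: linear_diff[OF lin] linear_cmul[OF lin] scaleR_diff_right mult.commute)
  qed (simp add: positive_scalar[of 0, simplified])
  \<comment> \<open>The chain \<open>\<gamma> S\<^sup>n 1 \<le> S\<^sup>n u \<le> q\<^sup>n u \<le> q\<^sup>n \<kappa> \<gamma>\<close>, written as one sum of positive differences.\<close>
  have "positive ((1/\<gamma>) *\<^sub>R ((?S ^^ n) (u - \<gamma> *\<^sub>R 1) + (q ^ n *\<^sub>R u - (?S ^^ n) u)
      + q ^ n *\<^sub>R ((\<kappa> * \<gamma>) *\<^sub>R 1 - u)))"
    using \<gamma> q by (intro positive_scaleR positive_add sandwich_powers_positive \<eta> ge le A) auto
  also have "(?S ^^ n) (u - \<gamma> *\<^sub>R 1) = (?S ^^ n) u - \<gamma> *\<^sub>R (?S ^^ n) 1"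
    by (simp add: linear_diff[OF linp] linear_cmul[OF linp])
  also have "(1/\<gamma>) *\<^sub>R ((?S ^^ n) u - \<gamma> *\<^sub>R (?S ^^ n) 1 + (q ^ n *\<^sub>R u - (?S ^^ n) u)
      + q ^ n *\<^sub>R ((\<kappa> * \<gamma>) *\<^sub>R 1 - u)) = (\<kappa> * q ^ n) *\<^sub>R 1 - (?S ^^ n) 1"
    using \<gamma> by (simp add: algebra_simps)
  finally show ?thesis by (simp add: q_def)
qed

text \<open>
  For \<open>norm y \<le> 1\<close> start from the positive matrix with diagonal \<open>1\<close> and corner \<open>y\<close>. Its image under the powers has
  the mixed power of \<open>y\<close> in the corner, bounded by the diagonal through Cauchy-Schwarz.
\<close>

lemma mixed_sandwich_powers_norm:
  fixes p q x :: "'a::unital_cstar_algebra"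
  assumes \<eta>: "\<eta> \<in> two_positive_maps" and \<alpha>: "\<alpha> > 0"
    and p: "positive (\<alpha> *\<^sub>R 1 - (sandwich \<eta> p (star p) ^^ n) 1)"
    and q: "positive (\<alpha> *\<^sub>R 1 - (sandwich \<eta> (star q) q ^^ n) 1)"
  shows "norm ((sandwich \<eta> p q ^^ n) x) \<le> \<alpha> * norm x"
proof (cases "x = 0")
  case True
  then show ?thesis by (simp add: linear_0[OF sandwich_powers_linear])
next
  case False
  define y where "y = (1 / norm x) *\<^sub>R x"
  have y: "norm y \<le> 1" "x = norm x *\<^sub>R y" using False by (simp_all add: y_def)
  define d :: "2 \<Rightarrow> 'a" where "d = (\<lambda>i. if i = 1 then star p else q)"
  define E :: "'a ^ 2 ^ 2" where "E = (\<chi> i j. if i = j then 1 else if i = 1 then y else star y)"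
  define A :: "'a ^ 2 ^ 2" where
    "A = (\<chi> i j. (sandwich \<eta> (star (d i)) (d j) ^^ n) (E $ i $ j))"
  have "positive_mat A"
    unfolding A_def E_def by (intro sandwich_powers_positive_mat[OF \<eta>] positive_mat_unit_corner y)
  moreover have A: "A $ 1 $ 1 = (sandwich \<eta> p (star p) ^^ n) 1"
    "A $ 2 $ 2 = (sandwich \<eta> (star q) q ^^ n) 1" "A $ 1 $ 2 = (sandwich \<eta> p q ^^ n) y"
    by (simp_all add: A_def E_def d_def star_star)
  ultimately have "(norm (A $ 1 $ 2))\<^sup>2 \<le> \<alpha> * \<alpha>"
    using \<alpha> p q by (intro positive_mat_Cauchy_Schwarz) auto
  then have "norm (A $ 1 $ 2) \<le> \<alpha>"
    using \<alpha> power2_le_imp_le[of "norm (A $ 1 $ 2)" \<alpha>] by (simp add: power2_eq_square)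
  then have "norm (norm x *\<^sub>R (sandwich \<eta> p q ^^ n) y) \<le> \<alpha> * norm x"
    unfolding A norm_scaleR abs_norm_cancel mult.commute[of \<alpha>] by (rule mult_left_mono) simp
  also have "norm x *\<^sub>R (sandwich \<eta> p q ^^ n) y = (sandwich \<eta> p q ^^ n) x"
    by (metis linear_cmul[OF sandwich_powers_linear] y(2))
  finally show ?thesis .
qed

section \<open>Points on the graph of a solution\<close>

text \<open>
  A point of the graph, without reference to the solution at other \<open>b\<close>. The comparison of points for different
  \<open>\<eta>\<close> needs this freedom: \<open>g\<close> is reinterpreted as a value at another \<open>b\<close> for another \<open>\<eta>\<close>.
\<close>

definition dyson_point :: "('a::unital_cstar_algebra \<Rightarrow>\<^sub>L 'a) \<Rightarrow> real \<Rightarrow> 'a \<Rightarrow> 'a \<Rightarrow> bool" where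
  "dyson_point \<eta> \<gamma> b g \<longleftrightarrow> b \<in> upper_half_ge \<gamma> \<and> g \<in> lower_half \<and> b * g = 1 + \<eta> g * g"

lemma lower_half_positive:
  assumes "g \<in> lower_half" shows "positive (- Im_part g)"
proof -
  obtain \<epsilon> where \<epsilon>: "\<epsilon> > 0" and pos: "positive (- Im_part g - \<epsilon> *\<^sub>R 1)"
    using assms by (auto simp: lower_half_def cstar_le_def)
  from positive_add[OF pos positive_scalar[of \<epsilon>]] \<epsilon> show ?thesis by simp
qed

lemma dyson_point_inverse:
  assumes "dyson_point \<eta> \<gamma> b g"
  shows "(b - \<eta> g) * g = 1" "g * (b - \<eta> g) = 1"
proof -
  show wg: "(b - \<eta> g) * g = 1" using assms by (simp add: dyson_point_def algebra_simps)
  show "g * (b - \<eta> g) = 1"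
    using assms by (intro lower_half_left_inverse[OF _ wg]) (simp add: dyson_point_def)
qed

text \<open>
  Both identities are the imaginary part of \<open>g = g w* g*\<close> and \<open>g = g* w* g\<close> for \<open>w = b - \<eta> g\<close>, the inverse of
  \<open>g\<close>. The first serves the sandwich by \<open>g\<close> and the second the one by \<open>star g\<close>.
\<close>

lemma dyson_point_Im_part:
  assumes "dyson_point \<eta> \<gamma> b g"
  shows "- Im_part g = g * Im_part (b - \<eta> g) * star g"
    and "- Im_part g = star g * Im_part (b - \<eta> g) * g"
proof -
  define w where "w = b - \<eta> g"
  have wg: "w * g = 1" "g * w = 1"
    using dyson_point_inverse[OF assms] by (simp_all add: w_def)
  have sw: "star g * star w = 1" "star w * star g = 1"
    using arg_cong[OF wg(1), of star] arg_cong[OF wg(2), of star] by (simp_all add: star_mult star_one)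
  have "g = g * star w * star g" by (simp add: mult.assoc sw)
  from arg_cong[OF this, of Im_part]
  have "Im_part g = g * Im_part (star w) * star g" by (simp only: Im_part_conj)
  then show "- Im_part g = g * Im_part (b - \<eta> g) * star g"
    by (simp only: Im_part_star w_def) simp
  have "g = star g * star w * star (star g)" by (simp add: sw star_star)
  from arg_cong[OF this, of Im_part]
  have "Im_part g = star g * Im_part (star w) * star (star g)" by (simp only: Im_part_conj)
  then show "- Im_part g = star g * Im_part (b - \<eta> g) * g"
    by (simp only: Im_part_star star_star w_def) simp
qed

lemma dyson_point_Im_part_denominator:
  assumes \<eta>: "\<eta> \<in> two_positive_maps" and pt: "dyson_point \<eta> \<gamma> b g"
  shows "positive (Im_part (b - \<eta> g) - (\<gamma> *\<^sub>R 1 + \<eta> (- Im_part g)))"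
  using pt by (simp add: dyson_point_def upper_half_ge_def cstar_le_def Im_part_diff
      two_positive_maps_Im_part[OF \<eta>] blinfun.minus_right)

text \<open>
  Multiplying \<open>Im_part (b - \<eta> g) \<ge> \<gamma>\<close> by \<open>star g\<close> and \<open>g\<close> gives \<open>- Im_part g \<ge> \<gamma> *\<^sub>R (star g * g)\<close>, so
  \<open>\<gamma> * (norm g)\<^sup>2 \<le> norm g\<close>.
\<close>

lemma dyson_point_norm:
  assumes \<eta>: "\<eta> \<in> two_positive_maps" and \<gamma>: "\<gamma> > 0" and pt: "dyson_point \<eta> \<gamma> b g"
  shows "norm g \<le> 1 / \<gamma>"
proof -
  define v where "v = Im_part (b - \<eta> g)"
  have "positive (\<eta> (- Im_part g))"
    using pt by (intro two_positive_maps_positive[OF \<eta>] lower_half_positive) (simp add: dyson_point_def)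
  from positive_add[OF dyson_point_Im_part_denominator[OF \<eta> pt] this]
  have "positive (v - \<gamma> *\<^sub>R 1)" by (simp add: v_def diff_diff_add[symmetric])
  then have "positive (star g * (v - \<gamma> *\<^sub>R 1) * g)" by (rule positive_conj)
  also have "star g * (v - \<gamma> *\<^sub>R 1) * g = - Im_part g - \<gamma> *\<^sub>R (star g * g)"
    by (simp add: dyson_point_Im_part(2)[OF pt] v_def algebra_simps)
  finally have "norm (\<gamma> *\<^sub>R (star g * g)) \<le> norm (- Im_part g)"
    using \<gamma> by (intro positive_norm_mono positive_scaleR positive_star_mult) auto
  also have "\<dots> \<le> norm g" using norm_Im_part by simp
  finally have "\<gamma> * (norm g)\<^sup>2 \<le> norm g" using \<gamma> by (simp add: cstar_identity)
  moreover have "g \<noteq> 0" using dyson_point_inverse[OF pt] by auto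
  ultimately have "\<gamma> * norm g \<le> 1" by (simp add: power2_eq_square mult.assoc[symmetric] del: mult.assoc)
  then show ?thesis using \<gamma> by (simp add: field_simps)
qed

text \<open>
  The heart of the matter. Put \<open>y = - Im_part g\<close>, \<open>v = Im_part (b - \<eta> g)\<close> and \<open>u = \<gamma> + \<eta> y\<close>. Then \<open>u \<le> v\<close> and
  \<open>y = p v p*\<close>, so the sandwich of \<open>u\<close> is at most \<open>\<eta> y = u - \<gamma>\<close>. Working with \<open>u\<close> instead of \<open>v\<close> makes the
  constants independent of \<open>b\<close>: \<open>v\<close> contains the imaginary part of \<open>b\<close>, whereas \<open>\<eta> y\<close> has norm at most
  \<open>norm \<eta> / \<gamma>\<close>. The summand 2 in \<open>\<kappa>\<close>, rather than 1, keeps the ratio \<open>1 - 1 / \<kappa>\<close>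
  away from 0 even for \<open>\<eta> = 0\<close>, as the division in \<open>positive_mat_Cauchy_Schwarz\<close> requires.
\<close>

lemma dyson_point_sandwich_dominated:
  assumes \<eta>: "\<eta> \<in> two_positive_maps" and \<gamma>: "\<gamma> > 0" and pt: "dyson_point \<eta> \<gamma> b g"
    and p: "p = g \<or> p = star g" and \<kappa>: "\<kappa> = 2 + norm \<eta> / \<gamma>\<^sup>2"
  shows "positive ((\<kappa> * (1 - 1 / \<kappa>) ^ n) *\<^sub>R 1 - (sandwich \<eta> p (star p) ^^ n) 1)"
proof -
  define y v u where "y = - Im_part g" and "v = Im_part (b - \<eta> g)" and "u = \<gamma> *\<^sub>R 1 + \<eta> y"
  have "positive y" unfolding y_def
    using pt by (intro lower_half_positive) (simp add: dyson_point_def)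
  then have \<eta>y: "positive (\<eta> y)" by (rule two_positive_maps_positive[OF \<eta>])
  have y: "y = p * v * star p"
    using p dyson_point_Im_part[OF pt] by (auto simp: y_def v_def star_star)
  have "norm (\<eta> y) \<le> norm \<eta> * norm y" by (rule norm_blinfun)
  also have "norm y \<le> 1 / \<gamma>"
    using norm_Im_part[of g] dyson_point_norm[OF \<eta> \<gamma> pt] by (simp add: y_def)
  finally have "norm (\<eta> y) \<le> norm \<eta> / \<gamma>" by (simp add: mult_left_mono)
  then have le: "positive ((norm \<eta> / \<gamma>) *\<^sub>R 1 - \<eta> y)"
    by (intro positive_scalar_minus positive_selfadjoint \<eta>y)
  show ?thesis
  proof (rule sandwich_powers_dominated[OF \<eta> \<gamma>, where u = u])
    show "\<kappa> \<ge> 1" unfolding \<kappa> by simp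
    show "positive (u - \<gamma> *\<^sub>R 1)" using \<eta>y by (simp add: u_def)
    have "(\<kappa> * \<gamma>) *\<^sub>R 1 - u = \<gamma> *\<^sub>R 1 + ((norm \<eta> / \<gamma>) *\<^sub>R 1 - \<eta> y)"
      using \<gamma> by (simp add: \<kappa> u_def power2_eq_square distrib_right scaleR_add_left)
         (simp add: algebra_simps flip: scaleR_add_left)
    also have "positive \<dots>" using \<gamma> by (intro positive_add le positive_scalar) simp
    finally show "positive ((\<kappa> * \<gamma>) *\<^sub>R 1 - u)" .
    \<comment> \<open>\<open>sandwich \<eta> p (star p)\<close> maps \<open>v\<close> to \<open>\<eta> y = u - \<gamma>\<close> and is monotone.\<close>
  have "positive (v - u)"
      using dyson_point_Im_part_denominator[OF \<eta> pt] by (simp add: v_def u_def y_def)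
    then have "positive (sandwich \<eta> p (star p) (v - u))" by (rule sandwich_positive[OF \<eta>])
    also have "sandwich \<eta> p (star p) (v - u) = \<eta> y - sandwich \<eta> p (star p) u"
      by (simp add: sandwich_def y algebra_simps blinfun.diff_right)
    finally show "positive (u - \<gamma> *\<^sub>R 1 - sandwich \<eta> p (star p) u)" by (simp add: u_def)
  qed
qed

text \<open>
  The two points enter the mixed sandwich asymmetrically: its diagonal parts are the sandwich by \<open>g1\<close> and the one
  by \<open>star g0\<close>.
\<close>

lemma dyson_points_geometric_powers:
  assumes \<eta>: "\<eta> \<in> two_positive_maps" and \<gamma>: "\<gamma> > 0"
    and pt: "dyson_point \<eta> \<gamma> b1 g1" "dyson_point \<eta> \<gamma> b0 g0"
    and \<kappa>: "\<kappa> = 2 + norm \<eta> / \<gamma>\<^sup>2"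
  shows "geometric_powers (sandwich \<eta> g1 g0) \<kappa> (1 - 1 / \<kappa>)"
proof (rule geometric_powers.intro)
  have \<kappa>2: "\<kappa> \<ge> 2" unfolding \<kappa> by simp
  show "bounded_linear (sandwich \<eta> g1 g0)" by (rule sandwich_bounded_linear)
  show "0 \<le> 1 - 1 / \<kappa>" "1 - 1 / \<kappa> < 1" using \<kappa>2 by simp_all
  show "norm ((sandwich \<eta> g1 g0 ^^ n) x) \<le> \<kappa> * (1 - 1 / \<kappa>) ^ n * norm x" for n x
  proof (rule mixed_sandwich_powers_norm[OF \<eta>])
    show "0 < \<kappa> * (1 - 1 / \<kappa>) ^ n" using \<kappa>2 by simp
    show "positive ((\<kappa> * (1 - 1 / \<kappa>) ^ n) *\<^sub>R 1 - (sandwich \<eta> g1 (star g1) ^^ n) 1)"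
      using dyson_point_sandwich_dominated[OF \<eta> \<gamma> pt(1) _ \<kappa>] by blast
    show "positive ((\<kappa> * (1 - 1 / \<kappa>) ^ n) *\<^sub>R 1 - (sandwich \<eta> (star g0) g0 ^^ n) 1)"
      using dyson_point_sandwich_dominated[OF \<eta> \<gamma> pt(2) _ \<kappa>, of "star g0"] by (simp add: star_star)
  qed
qed

text \<open>
  The sum \<open>\<kappa> / (1 - q) = \<kappa>\<^sup>2\<close> of the geometric bounds, for \<open>q = 1 - 1 / \<kappa>\<close>.
\<close>

definition stability_const :: "real \<Rightarrow> real \<Rightarrow> real" where
  "stability_const \<gamma> m = (2 + m / \<gamma>\<^sup>2)\<^sup>2"

lemma stability_const_nonneg: "stability_const \<gamma> m \<ge> 0"
  by (simp add: stability_const_def)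

lemma stability_const_mono:
  "0 \<le> m \<Longrightarrow> m \<le> m' \<Longrightarrow> stability_const \<gamma> m \<le> stability_const \<gamma> m'"
  unfolding stability_const_def by (intro power_mono add_left_mono divide_right_mono) auto

lemma stability_const_eq:
  assumes "\<kappa> = 2 + norm \<eta> / \<gamma>\<^sup>2"
  shows "\<kappa> / (1 - (1 - 1 / \<kappa>)) = stability_const \<gamma> (norm \<eta>)"
  by (simp only: stability_const_def assms[symmetric]) (simp add: power2_eq_square)

lemma dyson_points_fixed_point_norm:
  assumes "\<eta> \<in> two_positive_maps" "\<gamma> > 0" "dyson_point \<eta> \<gamma> b1 g1" "dyson_point \<eta> \<gamma> b0 g0"
    and "f = r + sandwich \<eta> g1 g0 f"
  shows "norm f \<le> stability_const \<gamma> (norm \<eta>) * norm r"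
  using geometric_powers.fixed_point_norm[OF dyson_points_geometric_powers[OF assms(1-4) refl] assms(5)]
  unfolding stability_const_eq[OF refl] .

section \<open>Stability under changes of the point and of the map\<close>

lemma norm_mult3: "norm (a * b * c) \<le> norm a * norm b * norm (c::'a::real_normed_algebra)"
  by (meson mult_right_mono norm_ge_zero norm_mult_ineq order_trans)

lemma upper_half_ge_perturb:
  fixes b b' :: "'a::unital_cstar_algebra"
  assumes b: "b \<in> upper_half_ge \<gamma>" and d: "norm (b' - b) \<le> \<gamma> / 2"
  shows "b' \<in> upper_half_ge (\<gamma> / 2)"
proof -
  have "norm (Im_part (b - b')) \<le> \<gamma> / 2"
    using d norm_Im_part[of "b - b'"] by (simp add: norm_minus_commute)
  then have "positive ((Im_part b - \<gamma> *\<^sub>R 1) + ((\<gamma> / 2) *\<^sub>R 1 - Im_part (b - b')))"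
    using b by (intro positive_add positive_scalar_minus star_Im_part)
      (auto simp: upper_half_ge_def cstar_le_def)
  also have "(Im_part b - \<gamma> *\<^sub>R 1) + ((\<gamma> / 2) *\<^sub>R 1 - Im_part (b - b')) = Im_part b' - (\<gamma> / 2) *\<^sub>R 1"
    using scaleR_add_left[of "\<gamma> / 2" "\<gamma> / 2" "1::'a"] by (simp add: Im_part_diff)
  finally show ?thesis by (simp add: upper_half_ge_def cstar_le_def)
qed

lemma upper_half_ge_half: "b \<in> upper_half_ge \<gamma> \<Longrightarrow> 0 < \<gamma> \<Longrightarrow> b \<in> upper_half_ge (\<gamma> / 2)"
  using upper_half_ge_perturb[of b \<gamma> b] by simp

text \<open>
  With \<open>w = b - \<eta> g\<close> the inverse of \<open>g\<close>, the element \<open>f = w0 - w1\<close> solves a linear equation exactly, without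
  a remainder, and determines \<open>g1 - g0\<close> by the resolvent identity.
\<close>

lemma dyson_points_difference:
  assumes \<eta>: "\<eta> \<in> two_positive_maps" and \<gamma>: "\<gamma> > 0"
    and pt: "dyson_point \<eta> \<gamma> b1 g1" "dyson_point \<eta> \<gamma> b0 g0"
  obtains f where "g1 - g0 = g1 * f * g0" "f = (b0 - b1) + sandwich \<eta> g1 g0 f"
    "norm f \<le> stability_const \<gamma> (norm \<eta>) * norm (b1 - b0)"
proof -
  define f where "f = (b0 - \<eta> g0) - (b1 - \<eta> g1)"
  have "g1 * f * g0 = g1 * ((b0 - \<eta> g0) * g0) - g1 * (b1 - \<eta> g1) * g0"
    by (simp add: f_def algebra_simps)
  then have d: "g1 - g0 = g1 * f * g0"
    unfolding dyson_point_inverse(1)[OF pt(2)] dyson_point_inverse(2)[OF pt(1)] by simp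
  have f: "f = (b0 - b1) + sandwich \<eta> g1 g0 f"
    unfolding sandwich_def d[symmetric] by (simp add: f_def blinfun.diff_right)
  from dyson_points_fixed_point_norm[OF \<eta> \<gamma> pt f] d f
  show thesis by (intro that) (auto simp: norm_minus_commute)
qed

lemma dyson_points_Lipschitz:
  assumes \<eta>: "\<eta> \<in> two_positive_maps" and \<gamma>: "\<gamma> > 0"
    and pt: "dyson_point \<eta> \<gamma> b1 g1" "dyson_point \<eta> \<gamma> b0 g0"
  shows "norm (g1 - g0) \<le> stability_const \<gamma> (norm \<eta>) / \<gamma>\<^sup>2 * norm (b1 - b0)"
proof -
  obtain f where f: "g1 - g0 = g1 * f * g0"
    "norm f \<le> stability_const \<gamma> (norm \<eta>) * norm (b1 - b0)"
    using dyson_points_difference[OF assms] by metis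
  have "norm (g1 - g0) \<le> norm g1 * norm f * norm g0" unfolding f(1) by (rule norm_mult3)
  also have "\<dots> \<le> (1 / \<gamma>) * (stability_const \<gamma> (norm \<eta>) * norm (b1 - b0)) * (1 / \<gamma>)"
    using \<gamma> stability_const_nonneg
    by (intro mult_mono f(2) dyson_point_norm[OF \<eta> \<gamma> pt(1)] dyson_point_norm[OF \<eta> \<gamma> pt(2)]
        mult_nonneg_nonneg) auto
  finally show ?thesis using \<gamma> by (simp add: power2_eq_square)
qed

text \<open>
  The change of \<open>\<eta>\<close> is absorbed in \<open>b\<close>, so that all comparisons reduce to a single map.
\<close>

lemma dyson_point_change_map:
  assumes \<eta>: "\<eta>0 \<in> two_positive_maps" and \<gamma>: "\<gamma> > 0" and pt: "dyson_point \<eta>0 \<gamma> b g"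
    and d: "norm (\<eta>1 - \<eta>0) \<le> \<gamma>\<^sup>2 / 2"
  shows "dyson_point \<eta>1 (\<gamma> / 2) (b + (\<eta>1 - \<eta>0) g) g"
proof -
  have "norm ((\<eta>1 - \<eta>0) g) \<le> norm (\<eta>1 - \<eta>0) * norm g" by (rule norm_blinfun)
  also have "\<dots> \<le> (\<gamma>\<^sup>2 / 2) * (1 / \<gamma>)"
    by (intro mult_mono d dyson_point_norm[OF \<eta> \<gamma> pt]) auto
  finally have "b + (\<eta>1 - \<eta>0) g \<in> upper_half_ge (\<gamma> / 2)"
    using pt \<gamma> by (intro upper_half_ge_perturb[of b]) (auto simp: dyson_point_def power2_eq_square)
  with pt show ?thesis by (simp add: dyson_point_def algebra_simps blinfun.diff_left)
qed

section \<open>The derivative\<close>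

text \<open>
  Differentiating \<open>w = b - \<eta> g\<close>, \<open>g = w\<inverse>\<close> in direction \<open>h\<close> gives \<open>w' = h + \<eta> (g w' g)\<close> and \<open>g' = - g w' g\<close>.
\<close>

definition dyson_derivative :: "('a::unital_cstar_algebra \<Rightarrow>\<^sub>L 'a) \<Rightarrow> 'a \<Rightarrow> 'a \<Rightarrow>\<^sub>L 'a" where
  "dyson_derivative \<eta> g = Blinfun (\<lambda>h. - (g * neumann (sandwich \<eta> g g) h * g))"

lemma neumann_sandwich:
  assumes "\<eta> \<in> two_positive_maps" "\<gamma> > 0" "dyson_point \<eta> \<gamma> b g"
  shows "bounded_linear (neumann (sandwich \<eta> g g))"
    and "neumann (sandwich \<eta> g g) h = h + sandwich \<eta> g g (neumann (sandwich \<eta> g g) h)"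
    and "norm (neumann (sandwich \<eta> g g) h) \<le> stability_const \<gamma> (norm \<eta>) * norm h"
proof -
  interpret geometric_powers "sandwich \<eta> g g" "2 + norm \<eta> / \<gamma>\<^sup>2" "1 - 1 / (2 + norm \<eta> / \<gamma>\<^sup>2)"
    using dyson_points_geometric_powers[OF assms(1-3) assms(3) refl] .
  show "bounded_linear (neumann (sandwich \<eta> g g))" by (rule neumann_bounded_linear)
  show "neumann (sandwich \<eta> g g) h = h + sandwich \<eta> g g (neumann (sandwich \<eta> g g) h)"
    by (rule neumann_fixed_point)
  show "norm (neumann (sandwich \<eta> g g) h) \<le> stability_const \<gamma> (norm \<eta>) * norm h"
    using neumann_norm unfolding stability_const_eq[OF refl] .
qed

lemma neumann_sandwich_scaleC:
  assumes "\<eta> \<in> two_positive_maps" "\<gamma> > 0" "dyson_point \<eta> \<gamma> b g"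
  shows "neumann (sandwich \<eta> g g) (c *\<^sub>C h) = c *\<^sub>C neumann (sandwich \<eta> g g) h"
proof -
  interpret geometric_powers "sandwich \<eta> g g" "2 + norm \<eta> / \<gamma>\<^sup>2" "1 - 1 / (2 + norm \<eta> / \<gamma>\<^sup>2)"
    using dyson_points_geometric_powers[OF assms(1-3) assms(3) refl] .
  have "sandwich \<eta> g g (c *\<^sub>C x) = c *\<^sub>C sandwich \<eta> g g x" for x
    by (simp add: sandwich_def mult_scaleC_left mult_scaleC_right two_positive_maps_scaleC[OF assms(1)])
  then have "(sandwich \<eta> g g ^^ n) (c *\<^sub>C h) = c *\<^sub>C (sandwich \<eta> g g ^^ n) h" for n
    by (induction n) simp_all
  then show ?thesis
    by (simp add: neumann_def bounded_linear.suminf[OF scaleC_bounded_linear summable_powers])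
qed

lemma dyson_derivative_apply:
  assumes "\<eta> \<in> two_positive_maps" "\<gamma> > 0" "dyson_point \<eta> \<gamma> b g"
  shows "dyson_derivative \<eta> g h = - (g * neumann (sandwich \<eta> g g) h * g)"
  unfolding dyson_derivative_def
  by (subst bounded_linear_Blinfun_apply)
     (intro bounded_linear_minus bounded_linear_compose[OF bounded_linear_mult_left]
        bounded_linear_compose[OF bounded_linear_mult_right] neumann_sandwich(1)[OF assms], rule refl)

lemma dyson_derivative_clinear:
  assumes "\<eta> \<in> two_positive_maps" "\<gamma> > 0" "dyson_point \<eta> \<gamma> b g"
  shows "dyson_derivative \<eta> g \<in> clinear_ops"
  by (simp add: clinear_ops_def dyson_derivative_apply[OF assms] neumann_sandwich_scaleC[OF assms]
      mult_scaleC_left mult_scaleC_right scaleC_minus_right)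

text \<open>
  The exact linear equation of the difference and the Neumann series that defines the derivative agree up to replacing
  one factor \<open>g1\<close> by \<open>g0\<close>, and \<open>g1 - g0\<close> is already known to be of first order.
\<close>

lemma dyson_derivative_remainder:
  assumes \<eta>: "\<eta> \<in> two_positive_maps" and \<gamma>: "\<gamma> > 0"
    and pt: "dyson_point \<eta> \<gamma> b1 g1" "dyson_point \<eta> \<gamma> b0 g0"
    and K: "K = stability_const \<gamma> (norm \<eta>)"
  shows "norm (g1 - g0 - dyson_derivative \<eta> g0 (b1 - b0))
    \<le> K\<^sup>2 / \<gamma> ^ 3 * (1 + K * norm \<eta> / \<gamma>\<^sup>2) * (norm (b1 - b0))\<^sup>2"
proof -
  obtain f where d: "g1 - g0 = g1 * f * g0" and f: "f = (b0 - b1) + sandwich \<eta> g1 g0 f"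
    and nf: "norm f \<le> K * norm (b1 - b0)"
    unfolding K by (rule dyson_points_difference[OF \<eta> \<gamma> pt])
  have K0: "K \<ge> 0" unfolding K by (rule stability_const_nonneg)
  define x where "x = norm (b1 - b0)"
  define N where "N = neumann (sandwich \<eta> g0 g0)"
  define p where "p = N (b0 - b1)"
  have p: "p = (b0 - b1) + sandwich \<eta> g0 g0 p"
    unfolding p_def N_def by (rule neumann_sandwich(2)[OF \<eta> \<gamma> pt(2)])
  have ng0: "norm g0 \<le> 1 / \<gamma>" by (rule dyson_point_norm[OF \<eta> \<gamma> pt(2)])
  have nd: "norm (g1 - g0) \<le> K / \<gamma>\<^sup>2 * x"
    unfolding K x_def by (rule dyson_points_Lipschitz[OF \<eta> \<gamma> pt])
  \<comment> \<open>The linear equations of \<open>f\<close> and \<open>p\<close> differ only in \<open>g1\<close> against \<open>g0\<close>, so that \<open>f - p\<close> solves the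
    equation of \<open>p\<close> with the second-order right-hand side \<open>\<eta> e\<close>.\<close>
  define e where "e = (g1 - g0) * f * g0"
  have "norm e \<le> norm (g1 - g0) * norm f * norm g0" unfolding e_def by (rule norm_mult3)
  also have "\<dots> \<le> (K / \<gamma>\<^sup>2 * x) * (K * x) * (1 / \<gamma>)"
    using \<gamma> K0 nf by (intro mult_mono nd ng0 mult_nonneg_nonneg) (auto simp: x_def)
  finally have e: "norm e \<le> K\<^sup>2 / \<gamma> ^ 3 * x\<^sup>2" by (simp add: power2_eq_square power3_eq_cube mult_ac)
  define r where "r = f - p"
  have "r = sandwich \<eta> g1 g0 f - sandwich \<eta> g0 g0 p"
    using f p unfolding r_def by (metis add_diff_cancel_left)
  also have "\<dots> = \<eta> e + sandwich \<eta> g0 g0 r"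
    by (simp add: sandwich_def e_def r_def algebra_simps blinfun.add_right blinfun.diff_right)
  finally have "norm r \<le> K * norm (\<eta> e)"
    unfolding K by (rule dyson_points_fixed_point_norm[OF \<eta> \<gamma> pt(2) pt(2)])
  also have "\<dots> \<le> K * (norm \<eta> * norm e)" by (intro mult_left_mono norm_blinfun K0)
  finally have r: "norm r \<le> K * norm \<eta> * norm e" by (simp add: mult.assoc)
  have "neumann (sandwich \<eta> g0 g0) (b1 - b0) = - p"
    using linear_neg[OF bounded_linear.linear[OF neumann_sandwich(1)[OF \<eta> \<gamma> pt(2)]], of "b0 - b1"]
    by (simp add: p_def N_def)
  then have "g1 - g0 - dyson_derivative \<eta> g0 (b1 - b0) = g1 * f * g0 - g0 * p * g0"
    by (simp add: dyson_derivative_apply[OF \<eta> \<gamma> pt(2)] d)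
  also have "\<dots> = e + g0 * r * g0" by (simp add: e_def r_def algebra_simps)
  also have "norm \<dots> \<le> norm e + norm g0 * norm r * norm g0"
    by (intro norm_triangle_mono norm_mult3 order_refl)
  also have "\<dots> \<le> norm e + (1 / \<gamma>) * (K * norm \<eta> * norm e) * (1 / \<gamma>)"
    using \<gamma> K0 by (intro add_left_mono mult_mono ng0 r mult_nonneg_nonneg) auto
  also have "\<dots> = (1 + K * norm \<eta> / \<gamma>\<^sup>2) * norm e"
    by (simp add: power2_eq_square algebra_simps)
  also have "\<dots> \<le> (1 + K * norm \<eta> / \<gamma>\<^sup>2) * (K\<^sup>2 / \<gamma> ^ 3 * x\<^sup>2)"
    using K0 by (intro mult_left_mono e) auto
  finally show ?thesis by (simp add: x_def mult_ac)
qed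

lemma dyson_solution_point:
  assumes "dyson_solution \<eta> G" "\<gamma> > 0" "b \<in> upper_half_ge \<gamma>"
  shows "dyson_point \<eta> \<gamma> b (G b)"
proof -
  have "b \<in> upper_half" using assms(2,3) by (auto simp: upper_half_def upper_half_ge_def)
  with assms show ?thesis by (auto simp: dyson_point_def dyson_solution_def)
qed

lemma dyson_solution_has_derivative:
  assumes \<eta>: "\<eta> \<in> two_positive_maps" and G: "dyson_solution \<eta> G"
    and \<gamma>: "\<gamma> > 0" and b: "b \<in> upper_half_ge \<gamma>"
  shows "(G has_derivative dyson_derivative \<eta> (G b)) (at b)"
proof -
  define \<delta> where "\<delta> = \<gamma> / 2"
  have \<delta>: "\<delta> > 0" using \<gamma> by (simp add: \<delta>_def)
  define K where "K = stability_const \<delta> (norm \<eta>)"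
  define C where "C = K\<^sup>2 / \<delta> ^ 3 * (1 + K * norm \<eta> / \<delta>\<^sup>2)"
  show ?thesis
  proof (rule has_derivativeI_sandwich[OF \<delta> blinfun.bounded_linear_right])
    show "((\<lambda>y. C * norm (y - b)) \<longlongrightarrow> 0) (at b)"
      by (auto intro!: tendsto_eq_intros)
    fix y assume "y \<noteq> b" and "dist y b < \<delta>"
    then have "y \<in> upper_half_ge \<delta>" "b \<in> upper_half_ge \<delta>"
      using b upper_half_ge_half[OF b \<gamma>] upper_half_ge_perturb[OF b, of y]
      by (auto simp: \<delta>_def dist_norm)
    then have "dyson_point \<eta> \<delta> y (G y)" "dyson_point \<eta> \<delta> b (G b)"
      using G \<delta> by (auto intro: dyson_solution_point)
    from dyson_derivative_remainder[OF \<eta> \<delta> this K_def]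
    have "norm (G y - G b - dyson_derivative \<eta> (G b) (y - b)) \<le> C * (norm (y - b))\<^sup>2"
      by (simp add: C_def)
    then show "norm (G y - G b - dyson_derivative \<eta> (G b) (y - b)) / norm (y - b) \<le> C * norm (y - b)"
      using \<open>y \<noteq> b\<close> by (simp add: divide_le_eq power2_eq_square mult.assoc)
  qed
qed

lemma cfrechet_deriv_dyson_solution:
  assumes \<eta>: "\<eta> \<in> two_positive_maps" and G: "dyson_solution \<eta> G"
    and \<gamma>: "\<gamma> > 0" and b: "b \<in> upper_half_ge \<gamma>"
  shows "cfrechet_deriv G b = dyson_derivative \<eta> (G b)"
  unfolding cfrechet_deriv_def
proof (rule the_equality)
  have D: "(G has_derivative dyson_derivative \<eta> (G b)) (at b)"
    by (rule dyson_solution_has_derivative[OF assms])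
  then show "dyson_derivative \<eta> (G b) \<in> clinear_ops \<and> (G has_derivative dyson_derivative \<eta> (G b)) (at b)"
    using dyson_derivative_clinear[OF \<eta> \<gamma> dyson_solution_point[OF G \<gamma> b]] by blast
  show "E = dyson_derivative \<eta> (G b)" if "E \<in> clinear_ops \<and> (G has_derivative blinfun_apply E) (at b)" for E
    using has_derivative_unique[OF _ D, of E] that by (simp add: blinfun_apply_inject)
qed

text \<open>
  The Neumann series \<open>p1\<close> and \<open>p0\<close> at the two points satisfy equations whose difference is again of the form
  \<open>f = r + sandwich \<eta>1 g1 g1 f\<close>, with \<open>r\<close> controlled by \<open>\<eta>1 - \<eta>0\<close> and \<open>g1 - g0\<close>.
\<close>

lemma dyson_derivative_Lipschitz:
  assumes \<eta>: "\<eta>1 \<in> two_positive_maps" "\<eta>0 \<in> two_positive_maps" and \<gamma>: "\<gamma> > 0"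
    and pt: "dyson_point \<eta>1 \<gamma> b1 g1" "dyson_point \<eta>0 \<gamma> b0 g0"
    and K: "stability_const \<gamma> (norm \<eta>1) \<le> K" "stability_const \<gamma> (norm \<eta>0) \<le> K"
  shows "norm (dyson_derivative \<eta>1 g1 - dyson_derivative \<eta>0 g0)
    \<le> (K / \<gamma>\<^sup>2 * (norm (\<eta>1 - \<eta>0) / \<gamma>\<^sup>2 + norm \<eta>0 * (2 / \<gamma> * norm (g1 - g0))) + 2 / \<gamma> * norm (g1 - g0)) * K"
    (is "_ \<le> ?C * K")
proof (rule norm_blinfun_bound)
  have K0: "K \<ge> 0" using K(1) stability_const_nonneg order_trans by blast
  then show "0 \<le> ?C * K" using \<gamma> by (intro mult_nonneg_nonneg add_nonneg_nonneg) auto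
  fix h
  define p1 p0 where "p1 = neumann (sandwich \<eta>1 g1 g1) h" and "p0 = neumann (sandwich \<eta>0 g0 g0) h"
  have p: "p1 = h + sandwich \<eta>1 g1 g1 p1" "p0 = h + sandwich \<eta>0 g0 g0 p0"
    unfolding p1_def p0_def
    using neumann_sandwich(2)[OF \<eta>(1) \<gamma> pt(1)] neumann_sandwich(2)[OF \<eta>(2) \<gamma> pt(2)] by blast+
  have "norm p0 \<le> stability_const \<gamma> (norm \<eta>0) * norm h"
    unfolding p0_def by (rule neumann_sandwich(3)[OF \<eta>(2) \<gamma> pt(2)])
  also have "\<dots> \<le> K * norm h" by (intro mult_right_mono K) simp
  finally have np: "norm p0 \<le> K * norm h" .
  have ng: "norm g1 \<le> 1 / \<gamma>" "norm g0 \<le> 1 / \<gamma>"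
    using dyson_point_norm[OF \<eta>(1) \<gamma> pt(1)] dyson_point_norm[OF \<eta>(2) \<gamma> pt(2)] .
  define e where "e = g1 * p0 * g1 - g0 * p0 * g0"
  have "e = (g1 - g0) * p0 * g1 + g0 * p0 * (g1 - g0)" by (simp add: e_def algebra_simps)
  also have "norm \<dots> \<le> norm (g1 - g0) * norm p0 * norm g1 + norm g0 * norm p0 * norm (g1 - g0)"
    by (intro norm_triangle_mono norm_mult3)
  also have "\<dots> \<le> norm (g1 - g0) * norm p0 * (1 / \<gamma>) + (1 / \<gamma>) * norm p0 * norm (g1 - g0)"
    using \<gamma> ng by (intro add_mono mult_mono mult_nonneg_nonneg) auto
  finally have e: "norm e \<le> 2 / \<gamma> * norm (g1 - g0) * norm p0" by (simp add: mult_ac)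
  define r where "r = (\<eta>1 - \<eta>0) (g1 * p0 * g1) + \<eta>0 e"
  have "p1 - p0 = sandwich \<eta>1 g1 g1 p1 - sandwich \<eta>0 g0 g0 p0"
    using p by (metis add_diff_cancel_left)
  also have "\<dots> = r + sandwich \<eta>1 g1 g1 (p1 - p0)"
    by (simp add: r_def e_def sandwich_def algebra_simps blinfun.diff_right blinfun.diff_left)
  finally have "norm (p1 - p0) \<le> stability_const \<gamma> (norm \<eta>1) * norm r"
    by (rule dyson_points_fixed_point_norm[OF \<eta>(1) \<gamma> pt(1) pt(1)])
  also have "\<dots> \<le> K * norm r" by (intro mult_right_mono K) simp
  also have "K * norm r \<le> K * (norm (\<eta>1 - \<eta>0) * (1 / \<gamma> * norm p0 * (1 / \<gamma>)) + norm \<eta>0 * (2 / \<gamma> * norm (g1 - g0) * norm p0))"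
    unfolding r_def
  proof (intro mult_left_mono[OF _ K0] norm_triangle_mono order_trans[OF norm_blinfun] mult_left_mono e norm_ge_zero)
    show "norm (g1 * p0 * g1) \<le> 1 / \<gamma> * norm p0 * (1 / \<gamma>)"
      using \<gamma> ng by (intro order_trans[OF norm_mult3] mult_mono mult_nonneg_nonneg) auto
  qed
  finally have d: "norm (p1 - p0)
      \<le> K * (norm (\<eta>1 - \<eta>0) / \<gamma>\<^sup>2 + norm \<eta>0 * (2 / \<gamma> * norm (g1 - g0))) * norm p0"
    by (simp add: power2_eq_square algebra_simps)
  have "(dyson_derivative \<eta>1 g1 - dyson_derivative \<eta>0 g0) h = - (g1 * (p1 - p0) * g1 + e)"
    by (simp add: blinfun.diff_left dyson_derivative_apply[OF \<eta>(1) \<gamma> pt(1)]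
        dyson_derivative_apply[OF \<eta>(2) \<gamma> pt(2)] e_def algebra_simps flip: p1_def p0_def)
  also have "norm \<dots> \<le> 1 / \<gamma> * norm (p1 - p0) * (1 / \<gamma>) + 2 / \<gamma> * norm (g1 - g0) * norm p0"
    unfolding norm_minus_cancel
  proof (intro norm_triangle_mono e)
    show "norm (g1 * (p1 - p0) * g1) \<le> 1 / \<gamma> * norm (p1 - p0) * (1 / \<gamma>)"
      using \<gamma> ng by (intro order_trans[OF norm_mult3] mult_mono mult_nonneg_nonneg) auto
  qed
  also have "\<dots> = norm (p1 - p0) / \<gamma>\<^sup>2 + 2 / \<gamma> * norm (g1 - g0) * norm p0"
    by (simp add: power2_eq_square)
  also have "\<dots> \<le> K * (norm (\<eta>1 - \<eta>0) / \<gamma>\<^sup>2 + norm \<eta>0 * (2 / \<gamma> * norm (g1 - g0))) * norm p0 / \<gamma>\<^sup>2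
      + 2 / \<gamma> * norm (g1 - g0) * norm p0"
    by (intro add_right_mono divide_right_mono d) simp
  also have "\<dots> = ?C * norm p0" by (simp add: algebra_simps add_divide_distrib)
  also have "\<dots> \<le> ?C * (K * norm h)"
    using \<gamma> K0 by (intro mult_left_mono np mult_nonneg_nonneg add_nonneg_nonneg) auto
  finally show "norm ((dyson_derivative \<eta>1 g1 - dyson_derivative \<eta>0 g0) h) \<le> ?C * K * norm h"
    by (simp add: mult.assoc)
qed

section \<open>Equicontinuity\<close>

text \<open>
  The constant is computed at level \<open>\<gamma> / 2\<close>, because changing the map moves the point by up to \<open>\<gamma> / 2\<close>.
\<close>

lemma dyson_points_uniform_Lipschitz:
  fixes \<gamma> m :: real
  assumes \<gamma>: "\<gamma> > 0" and m: "m \<ge> 0"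
  shows "\<exists>C. \<forall>\<eta>1\<in>two_positive_maps. \<forall>\<eta>0\<in>two_positive_maps. \<forall>b1 b0 g1 g0 :: 'a::unital_cstar_algebra.
    norm \<eta>1 \<le> m \<longrightarrow> norm \<eta>0 \<le> m \<longrightarrow> norm (\<eta>1 - \<eta>0) \<le> \<gamma>\<^sup>2 / 2 \<longrightarrow>
    dyson_point \<eta>1 \<gamma> b1 g1 \<longrightarrow> dyson_point \<eta>0 \<gamma> b0 g0 \<longrightarrow>
    norm (g1 - g0) \<le> C * (norm (b1 - b0) + norm (\<eta>1 - \<eta>0)) \<and>
    norm (dyson_derivative \<eta>1 g1 - dyson_derivative \<eta>0 g0) \<le> C * (norm (b1 - b0) + norm (\<eta>1 - \<eta>0))"
proof -
  define \<delta> where "\<delta> = \<gamma> / 2"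
  have \<delta>: "\<delta> > 0" using \<gamma> by (simp add: \<delta>_def)
  define K where "K = stability_const \<delta> m"
  have K0: "K \<ge> 0" unfolding K_def by (rule stability_const_nonneg)
  define C1 where "C1 = K / \<delta>\<^sup>2 * (1 + 1 / \<gamma>)"
  have C1: "C1 \<ge> 0" using K0 \<gamma> by (simp add: C1_def)
  define C2 where "C2 = (K / \<delta>\<^sup>2 * (1 / \<delta>\<^sup>2 + m * (2 / \<delta> * C1)) + 2 / \<delta> * C1) * K"
  have "norm (g1 - g0) \<le> C1 * (norm (b1 - b0) + norm (\<eta>1 - \<eta>0)) \<and>
    norm (dyson_derivative \<eta>1 g1 - dyson_derivative \<eta>0 g0) \<le> C2 * (norm (b1 - b0) + norm (\<eta>1 - \<eta>0))"
    if \<eta>: "\<eta>1 \<in> two_positive_maps" "\<eta>0 \<in> two_positive_maps"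
      and nm: "norm \<eta>1 \<le> m" "norm \<eta>0 \<le> m" and d: "norm (\<eta>1 - \<eta>0) \<le> \<gamma>\<^sup>2 / 2"
      and pt\<gamma>: "dyson_point \<eta>1 \<gamma> b1 g1" "dyson_point \<eta>0 \<gamma> b0 g0"
    for \<eta>1 \<eta>0 and b1 b0 g1 g0 :: 'a
  proof
    define x e where "x = norm (b1 - b0)" and "e = norm (\<eta>1 - \<eta>0)"
    have xe: "x \<ge> 0" "e \<ge> 0" by (simp_all add: x_def e_def)
    have pt: "dyson_point \<eta>1 \<delta> b1 g1" "dyson_point \<eta>0 \<delta> b0 g0"
      using pt\<gamma> upper_half_ge_half[OF _ \<gamma>] by (auto simp: dyson_point_def \<delta>_def)
    have K: "stability_const \<delta> (norm \<eta>1) \<le> K" "stability_const \<delta> (norm \<eta>0) \<le> K"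
      unfolding K_def by (intro stability_const_mono nm norm_ge_zero)+
    \<comment> \<open>\<open>g0\<close> solves the equation of \<open>\<eta>1\<close> at the shifted point \<open>b\<close>, which still lies in the half-plane
      of level \<open>\<delta> = \<gamma> / 2\<close>; so both points can be compared for \<open>\<eta>1\<close>.\<close>
    define b where "b = b0 + (\<eta>1 - \<eta>0) g0"
    have "dyson_point \<eta>1 \<delta> b g0"
      using dyson_point_change_map[OF \<eta>(2) \<gamma> pt\<gamma>(2) d] by (simp add: b_def \<delta>_def)
    from dyson_points_Lipschitz[OF \<eta>(1) \<delta> pt(1) this]
    have "norm (g1 - g0) \<le> stability_const \<delta> (norm \<eta>1) / \<delta>\<^sup>2 * norm (b1 - b)" .
    also have "\<dots> \<le> K / \<delta>\<^sup>2 * norm (b1 - b)"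
      by (intro mult_right_mono divide_right_mono K) auto
    also have "norm (b1 - b) \<le> x + norm ((\<eta>1 - \<eta>0) g0)"
      unfolding x_def b_def diff_diff_add[symmetric] by (rule norm_triangle_ineq4)
    also have "norm ((\<eta>1 - \<eta>0) g0) \<le> e * (1 / \<gamma>)"
      unfolding e_def
      by (intro order_trans[OF norm_blinfun] mult_left_mono dyson_point_norm[OF \<eta>(2) \<gamma> pt\<gamma>(2)]) simp
    also have "x + e * (1 / \<gamma>) \<le> (1 + 1 / \<gamma>) * (x + e)"
      using xe \<gamma> by (simp add: algebra_simps add_divide_distrib)
    finally have "norm (g1 - g0) \<le> K / \<delta>\<^sup>2 * ((1 + 1 / \<gamma>) * (x + e))"
      using K0 by (simp add: mult_left_mono divide_right_mono)
    then have g: "norm (g1 - g0) \<le> C1 * (x + e)" by (simp add: C1_def mult.assoc)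
    then show "norm (g1 - g0) \<le> C1 * (norm (b1 - b0) + norm (\<eta>1 - \<eta>0))"
      by (simp only: x_def e_def)
    have "norm (dyson_derivative \<eta>1 g1 - dyson_derivative \<eta>0 g0)
      \<le> (K / \<delta>\<^sup>2 * (e / \<delta>\<^sup>2 + norm \<eta>0 * (2 / \<delta> * norm (g1 - g0))) + 2 / \<delta> * norm (g1 - g0)) * K"
      unfolding e_def by (rule dyson_derivative_Lipschitz[OF \<eta> \<delta> pt K])
    also have "\<dots> \<le> (K / \<delta>\<^sup>2 * ((x + e) / \<delta>\<^sup>2 + m * (2 / \<delta> * (C1 * (x + e)))) + 2 / \<delta> * (C1 * (x + e))) * K"
      using K0 \<delta> m xe C1
      by (intro mult_right_mono add_mono mult_left_mono mult_mono divide_right_mono g nm mult_nonneg_nonneg) auto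
    also have "\<dots> = C2 * (x + e)"
      by (simp add: C2_def algebra_simps add_divide_distrib)
    finally show "norm (dyson_derivative \<eta>1 g1 - dyson_derivative \<eta>0 g0)
        \<le> C2 * (norm (b1 - b0) + norm (\<eta>1 - \<eta>0))"
      by (simp only: x_def e_def)
  qed
  note * = this
  have "C1 * t \<le> max C1 C2 * t" "C2 * t \<le> max C1 C2 * t" if "t \<ge> 0" for t
    using that by (simp_all add: mult_right_mono)
  note ** = this[OF add_nonneg_nonneg[OF norm_ge_zero norm_ge_zero]]
  show ?thesis
    by (intro exI[of _ "max C1 C2"] conjI ballI allI impI)
      (blast intro: order_trans[OF conjunct1[OF *] **(1)] order_trans[OF conjunct2[OF *] **(2)])+
qed

text \<open>
  The form shared by the estimates for \<open>G\<close> and for its derivative: a Lipschitz constant that depends only on the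
  level of the half-plane and on a norm bound for the maps, valid for nearby maps.
\<close>

definition half_plane_Lipschitz ::
  "('a::unital_cstar_algebra \<Rightarrow>\<^sub>L 'a) set \<Rightarrow> (('a \<Rightarrow>\<^sub>L 'a) \<Rightarrow> 'a \<Rightarrow> 'c::real_normed_vector) \<Rightarrow> bool" where
  "half_plane_Lipschitz P F \<longleftrightarrow> (\<forall>\<gamma>>0. \<forall>m\<ge>0. \<exists>C. \<forall>\<eta>1\<in>P. \<forall>\<eta>0\<in>P.
     \<forall>b1\<in>upper_half_ge \<gamma>. \<forall>b0\<in>upper_half_ge \<gamma>.
     norm \<eta>1 \<le> m \<longrightarrow> norm \<eta>0 \<le> m \<longrightarrow> norm (\<eta>1 - \<eta>0) \<le> \<gamma>\<^sup>2 / 2 \<longrightarrow>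
     norm (F \<eta>1 b1 - F \<eta>0 b0) \<le> C * (norm (b1 - b0) + norm (\<eta>1 - \<eta>0)))"

lemma half_plane_Lipschitz_imp_equicontinuous:
  fixes F :: "('a::unital_cstar_algebra \<Rightarrow>\<^sub>L 'a) \<Rightarrow> 'a \<Rightarrow> 'c::real_normed_vector"
  assumes Lip: "half_plane_Lipschitz P F"
  shows "\<And>\<gamma> \<eta>0. \<gamma> > 0 \<Longrightarrow> \<eta>0 \<in> P \<Longrightarrow>
      ((\<lambda>\<eta>. SUP b\<in>upper_half_ge \<gamma>. ennreal (norm (F \<eta> b - F \<eta>0 b))) \<longlongrightarrow> 0) (at \<eta>0 within P)"
    and "continuous_on (P \<times> upper_half) (\<lambda>(\<eta>, b). F \<eta> b)"
proof -
  have local_Lip: "\<exists>C. \<forall>\<eta>\<in>P. \<forall>b1\<in>upper_half_ge \<gamma>. \<forall>b0\<in>upper_half_ge \<gamma>. dist \<eta> \<eta>0 < \<gamma>\<^sup>2 / 2 \<longrightarrow>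
      norm (F \<eta> b1 - F \<eta>0 b0) \<le> C * (norm (b1 - b0) + norm (\<eta> - \<eta>0))"
    if \<gamma>: "\<gamma> > 0" and \<eta>0: "\<eta>0 \<in> P" for \<gamma> \<eta>0
  proof -
    define m where "m = norm \<eta>0 + \<gamma>\<^sup>2 / 2"
    have "m \<ge> 0" "norm \<eta>0 \<le> m" by (simp_all add: m_def)
    moreover have "norm \<eta> \<le> m" if "dist \<eta> \<eta>0 < \<gamma>\<^sup>2 / 2" for \<eta>
      using that norm_triangle_sub[of \<eta> \<eta>0] by (simp add: m_def dist_norm)
    ultimately show ?thesis
      using Lip \<gamma> \<eta>0 unfolding half_plane_Lipschitz_def by (metis dist_norm less_imp_le)
  qed
  show "((\<lambda>\<eta>. SUP b\<in>upper_half_ge \<gamma>. ennreal (norm (F \<eta> b - F \<eta>0 b))) \<longlongrightarrow> 0) (at \<eta>0 within P)"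
    if \<gamma>: "\<gamma> > 0" and \<eta>0: "\<eta>0 \<in> P" for \<gamma> \<eta>0
  proof -
    obtain C where C: "\<And>\<eta> b. \<eta> \<in> P \<Longrightarrow> dist \<eta> \<eta>0 < \<gamma>\<^sup>2 / 2 \<Longrightarrow> b \<in> upper_half_ge \<gamma> \<Longrightarrow>
        norm (F \<eta> b - F \<eta>0 b) \<le> C * norm (\<eta> - \<eta>0)"
      using local_Lip[OF \<gamma> \<eta>0] by force
    have "((\<lambda>\<eta>. ennreal (C * norm (\<eta> - \<eta>0))) \<longlongrightarrow> ennreal 0) (at \<eta>0 within P)"
      by (intro tendsto_ennrealI) (auto intro!: tendsto_eq_intros)
    then have lim: "((\<lambda>\<eta>. ennreal (C * norm (\<eta> - \<eta>0))) \<longlongrightarrow> 0) (at \<eta>0 within P)" by simp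
    have ev: "\<forall>\<^sub>F \<eta> in at \<eta>0 within P.
        (SUP b\<in>upper_half_ge \<gamma>. ennreal (norm (F \<eta> b - F \<eta>0 b))) \<le> ennreal (C * norm (\<eta> - \<eta>0))"
      unfolding eventually_at using \<gamma>
      by (intro exI[of _ "\<gamma>\<^sup>2 / 2"]) (auto intro!: SUP_least ennreal_leI C)
    show ?thesis
      by (rule tendsto_sandwich[OF _ ev tendsto_const lim]) simp
  qed
  show "continuous_on (P \<times> upper_half) (\<lambda>(\<eta>, b). F \<eta> b)"
    unfolding continuous_on_def
  proof
    fix p0 :: "('a \<Rightarrow>\<^sub>L 'a) \<times> 'a" assume "p0 \<in> P \<times> upper_half"
    then obtain \<eta>0 b0 \<epsilon> where p0: "p0 = (\<eta>0, b0)" and \<eta>0: "\<eta>0 \<in> P"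
      and \<epsilon>: "\<epsilon> > 0" and b0: "b0 \<in> upper_half_ge \<epsilon>"
      by (auto simp: upper_half_def upper_half_ge_def)
    define \<gamma> where "\<gamma> = \<epsilon> / 2"
    have \<gamma>: "\<gamma> > 0" using \<epsilon> by (simp add: \<gamma>_def)
    obtain C where C: "\<And>\<eta> b. \<eta> \<in> P \<Longrightarrow> dist \<eta> \<eta>0 < \<gamma>\<^sup>2 / 2 \<Longrightarrow> b \<in> upper_half_ge \<gamma> \<Longrightarrow>
        norm (F \<eta> b - F \<eta>0 b0) \<le> C * (norm (b - b0) + norm (\<eta> - \<eta>0))"
      using local_Lip[OF \<gamma> \<eta>0] upper_half_ge_half[OF b0 \<epsilon>] unfolding \<gamma>_def by blast
    define r where "r = min \<gamma> (\<gamma>\<^sup>2 / 2)"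
    have r: "r > 0" using \<gamma> by (simp add: r_def)
    have ev: "\<forall>\<^sub>F p in at p0 within P \<times> upper_half. norm ((case p of (\<eta>, b) \<Rightarrow> F \<eta> b) - F \<eta>0 b0)
        \<le> C * (norm (snd p - b0) + norm (fst p - \<eta>0))"
      unfolding eventually_at
    proof (intro exI[of _ r] conjI r ballI impI)
      fix p assume p: "p \<in> P \<times> upper_half" "p \<noteq> p0 \<and> dist p p0 < r"
      obtain \<eta> b where pe: "p = (\<eta>, b)" by (cases p)
      have "dist \<eta> \<eta>0 < r" "dist b b0 < r"
        using p(2) dist_fst_le[of p p0] dist_snd_le[of p p0] by (auto simp: pe p0)
      then have "dist \<eta> \<eta>0 < \<gamma>\<^sup>2 / 2" "b \<in> upper_half_ge \<gamma>"
        using upper_half_ge_perturb[OF b0, of b] by (auto simp: r_def \<gamma>_def dist_norm)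
      then show "norm ((case p of (\<eta>, b) \<Rightarrow> F \<eta> b) - F \<eta>0 b0)
          \<le> C * (norm (snd p - b0) + norm (fst p - \<eta>0))"
        using p(1) C by (auto simp: pe)
    qed
    have "((\<lambda>p. C * (norm (snd p - b0) + norm (fst p - \<eta>0))) \<longlongrightarrow> 0) (at p0 within P \<times> upper_half)"
      unfolding p0 by (auto intro!: tendsto_eq_intros)
    from Lim_null_comparison[OF ev this]
    have "((\<lambda>p. (case p of (\<eta>, b) \<Rightarrow> F \<eta> b) - F \<eta>0 b0) \<longlongrightarrow> 0) (at p0 within P \<times> upper_half)" .
    then show "((\<lambda>(\<eta>, b). F \<eta> b) \<longlongrightarrow> (case p0 of (\<eta>, b) \<Rightarrow> F \<eta> b)) (at p0 within P \<times> upper_half)"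
      by (subst Lim_null) (simp add: p0 case_prod_unfold)
  qed
qed

theorem theorem1p2:
  fixes G :: "('a::unital_cstar_algebra \<Rightarrow>\<^sub>L 'a) \<Rightarrow> 'a \<Rightarrow> 'a"
  assumes "\<And>\<eta>. \<eta> \<in> two_positive_maps \<Longrightarrow> dyson_solution \<eta> (G \<eta>)"
  shows "(\<forall>\<gamma>>0. \<forall>\<eta>0\<in>two_positive_maps.
            ((\<lambda>\<eta>. SUP b\<in>upper_half_ge \<gamma>. ennreal (norm (G \<eta> b - G \<eta>0 b))) \<longlongrightarrow> 0)
              (at \<eta>0 within two_positive_maps))
       \<and> continuous_on (two_positive_maps \<times> upper_half) (\<lambda>(\<eta>, b). G \<eta> b)
       \<and> (\<forall>\<gamma>>0. \<forall>\<eta>0\<in>two_positive_maps.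
            ((\<lambda>\<eta>. SUP b\<in>upper_half_ge \<gamma>.
                 ennreal (norm (cfrechet_deriv (G \<eta>) b - cfrechet_deriv (G \<eta>0) b))) \<longlongrightarrow> 0)
              (at \<eta>0 within two_positive_maps))
       \<and> continuous_on (two_positive_maps \<times> upper_half) (\<lambda>(\<eta>, b). cfrechet_deriv (G \<eta>) b)"
proof -
  have "half_plane_Lipschitz two_positive_maps G \<and>
    half_plane_Lipschitz two_positive_maps (\<lambda>\<eta>. cfrechet_deriv (G \<eta>))"
    unfolding half_plane_Lipschitz_def all_conj_distrib[symmetric] imp_conjR[symmetric]
  proof (intro allI impI)
    fix \<gamma> m :: real assume \<gamma>: "\<gamma> > 0" and m: "m \<ge> 0"
    have point: "dyson_point \<eta> \<gamma> b (G \<eta> b)"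
      and deriv: "cfrechet_deriv (G \<eta>) b = dyson_derivative \<eta> (G \<eta> b)"
      if "\<eta> \<in> two_positive_maps" "b \<in> upper_half_ge \<gamma>" for \<eta> b
      using that by (simp_all add: dyson_solution_point[OF assms \<gamma>]
          cfrechet_deriv_dyson_solution[OF _ assms \<gamma>])
    obtain C where C: "\<forall>\<eta>1\<in>two_positive_maps. \<forall>\<eta>0\<in>two_positive_maps. \<forall>b1 b0 g1 g0 :: 'a.
        norm \<eta>1 \<le> m \<longrightarrow> norm \<eta>0 \<le> m \<longrightarrow> norm (\<eta>1 - \<eta>0) \<le> \<gamma>\<^sup>2 / 2 \<longrightarrow>
        dyson_point \<eta>1 \<gamma> b1 g1 \<longrightarrow> dyson_point \<eta>0 \<gamma> b0 g0 \<longrightarrow>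
        norm (g1 - g0) \<le> C * (norm (b1 - b0) + norm (\<eta>1 - \<eta>0)) \<and>
        norm (dyson_derivative \<eta>1 g1 - dyson_derivative \<eta>0 g0) \<le> C * (norm (b1 - b0) + norm (\<eta>1 - \<eta>0))"
      by (rule exE[OF dyson_points_uniform_Lipschitz[OF \<gamma> m]])
    have Lip: "norm (G \<eta>1 b1 - G \<eta>0 b0) \<le> C * (norm (b1 - b0) + norm (\<eta>1 - \<eta>0))"
      "norm (cfrechet_deriv (G \<eta>1) b1 - cfrechet_deriv (G \<eta>0) b0)
        \<le> C * (norm (b1 - b0) + norm (\<eta>1 - \<eta>0))"
      if "\<eta>1 \<in> two_positive_maps" "\<eta>0 \<in> two_positive_maps" "b1 \<in> upper_half_ge \<gamma>" "b0 \<in> upper_half_ge \<gamma>"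
        "norm \<eta>1 \<le> m" "norm \<eta>0 \<le> m" "norm (\<eta>1 - \<eta>0) \<le> \<gamma>\<^sup>2 / 2" for \<eta>1 \<eta>0 b1 b0
      using C that by (simp_all add: deriv point)
    show "(\<exists>C. \<forall>\<eta>1\<in>two_positive_maps. \<forall>\<eta>0\<in>two_positive_maps.
        \<forall>b1\<in>upper_half_ge \<gamma>. \<forall>b0\<in>upper_half_ge \<gamma>.
        norm \<eta>1 \<le> m \<longrightarrow> norm \<eta>0 \<le> m \<longrightarrow> norm (\<eta>1 - \<eta>0) \<le> \<gamma>\<^sup>2 / 2 \<longrightarrow>
        norm (G \<eta>1 b1 - G \<eta>0 b0) \<le> C * (norm (b1 - b0) + norm (\<eta>1 - \<eta>0))) \<and>
      (\<exists>C. \<forall>\<eta>1\<in>two_positive_maps. \<forall>\<eta>0\<in>two_positive_maps.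
        \<forall>b1\<in>upper_half_ge \<gamma>. \<forall>b0\<in>upper_half_ge \<gamma>.
        norm \<eta>1 \<le> m \<longrightarrow> norm \<eta>0 \<le> m \<longrightarrow> norm (\<eta>1 - \<eta>0) \<le> \<gamma>\<^sup>2 / 2 \<longrightarrow>
        norm (cfrechet_deriv (G \<eta>1) b1 - cfrechet_deriv (G \<eta>0) b0)
          \<le> C * (norm (b1 - b0) + norm (\<eta>1 - \<eta>0)))"
      by (intro conjI exI[of _ C] ballI impI; simp add: Lip)
  qed
  then have L: "half_plane_Lipschitz two_positive_maps G"
    "half_plane_Lipschitz two_positive_maps (\<lambda>\<eta>. cfrechet_deriv (G \<eta>))" by simp_all
  show ?thesis
    by (intro conjI allI impI ballI half_plane_Lipschitz_imp_equicontinuous L; assumption)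
qed

end
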